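(* Let $n$ be a positive integer and let $q\in\mathbb{C}$ with $0<|q|<1$ (fix a choice of $q^{1/2}$). (1) ($D_n$ Rogers–Ramanujan identities.) For $\delta\in\{0,1\}$, $$\sum_{\lambda\in\mathbb{Z}_{\ge}^n}\prod_{i=1}^n\left\{\frac{q^{(\delta+n-1)(\lambda_i-n+i)+(\lambda_i-n+i)^2}}{(q)_{\lambda_i}}\right\}\prod_{1\le i<j\le n}(1-q^{\lambda_i-\lambda_j})$$ $$=\frac12(-1)^{\binom n2}\prod_{i=1}^n\left\{\frac{(q^5;q^5)_\infty}{(q)_\infty}q^{(n-i)(n-i+\delta/2)}\right\}\det_{1\le i,j\le n}\left(q^{(j-1)(n-i+\delta/2)}\theta(q^{4n+2\delta+1-4i+j};q^5)+q^{-(j-1)(n-i+\delta/2)}\theta(q^{4n+2\delta+3-4i-j};q^5)\right).$$ (2) ($B_n$ Rogers–Ramanujan identity.) $$\sum_{\lambda\in\mathbb{Z}_{\ge}^n}\prod_{i=1}^n\left\{\frac{q^{(1+n)(\lambda_i-n+i)+(\lambda_i-n+i)^2}}{(q)_{\lambda_i}}\right\}\prod_{1\le i<j\le n}(1-q^{\lambda_i-\lambda_j})$$ $$=(-1)^{\binom n2+n}\prod_{i=1}^n\left\{\frac{(q^5;q^5)_\infty}{(q)_\infty}q^{(n-i+1/2)(n-i+1)}\right\}\det_{1\le i,j\le n}\left(q^{(j-1/2)(n-i+1)}\theta(q^{6+4n-4i+j};q^5)-q^{-(j-1/2)(n-i+1)}\theta(q^{7+4n-4i-j};q^5)\right).$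$
   Context: $\mathbb{Z}_{\ge}^n$ is the set of all $n$-tuples of non-negative integers (not necessarily ordered). $(a;q)_\infty=\prod_{i\ge0}(1-aq^i)$, $(q)_\infty=(q;q)_\infty$, $(q)_m=\prod_{i=1}^m(1-q^i)$ for integers $m\ge0$, and $\theta(z;q)=(z;q)_\infty(q/z;q)_\infty$. *)

theory Defs
  imports
    "HOL-Analysis.Infinite_Products"
    "HOL-Analysis.Infinite_Sum"
    "HOL-Library.FuncSet"
    "Jordan_Normal_Form.Determinant"
begin

definition qpoch_inf :: "complex \<Rightarrow> complex \<Rightarrow> complex" where
  "qpoch_inf a q = (\<Prod>i. 1 - a * q ^ i)"

definition qfac :: "complex \<Rightarrow> nat \<Rightarrow> complex" where
  "qfac q m = (\<Prod>i=1..m. 1 - q ^ i)"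

definition qtheta :: "complex \<Rightarrow> complex \<Rightarrow> complex" where
  "qtheta z q = qpoch_inf z q * qpoch_inf (q / z) q"

text \<open>An \<open>n\<close>-tuple of non-negative integers is a function on the index set
  \<open>{1..n}\<close>, made unique by the value \<open>undefined\<close> outside this set.\<close>

definition nat_tuples :: "nat \<Rightarrow> (nat \<Rightarrow> nat) set" where
  "nat_tuples n = {1..n} \<rightarrow>\<^sub>E UNIV"

text \<open>The determinant with row and column indices running over \<open>{1..n}\<close>; matrices
  themselves are indexed from 0.\<close>

definition det_upto :: "nat \<Rightarrow> (nat \<Rightarrow> nat \<Rightarrow> complex) \<Rightarrow> complex" where
  "det_upto n A = Determinant.det (Matrix.mat n n (\<lambda>(i, j). A (i + 1) (j + 1)))"

text \<open>In the identities below, half-integral powers of \<open>q\<close> are integral powers of a fixed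
  square root \<open>h\<close> of \<open>q\<close>, so each such exponent appears doubled: \<open>q\<close> to the power \<open>k / 2\<close> is
  \<open>h powi k\<close>.\<close>

end

theory Submission
  imports Defs
begin

text \<open>
  By Vandermonde's determinant the multiple sum equals, up to a power of \<open>q\<close>, the determinant of
  \<open>G\<^bsub>\<delta>+k-N\<^esub>\<close> with \<open>0 \<le> N, k < n\<close>, where \<open>G\<^sub>m = \<Sum>\<^sub>L q\<^bsup>L\<^sup>2+mL\<^esup> / (q)\<^sub>L\<close>
  (the \<open>B\<^sub>n\<close> sum is the case \<open>\<delta> = 2\<close>). For \<open>\<delta> \<in> {0, 1}\<close> put \<open>X\<^sub>r = q\<^bsup>r+\<delta>/2\<^esup>\<close> and
  \<open>w\<^sub>r = (-1)\<^sup>r q\<^bsup>(5r\<^sup>2-r)/2+2\<delta>r\<^esup>\<close>. By the Jacobi triple product the theta functions of the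
  statement are the moments of the functional \<open>\<Lambda> f = \<Sum>\<^sub>r w\<^sub>r f(X\<^sub>r) / (q)\<^sub>\<infinity>\<close>, and the symmetry
  \<open>r \<mapsto> -\<delta>-r\<close> turns the theta determinants into determinants of \<open>\<Lambda> (a\<^sub>N(u) b\<^sub>k(u))\<close>, where
  \<open>u = X + 1/X\<close> and \<open>a\<^sub>N\<close>, \<open>b\<^sub>k\<close> are monic of degrees \<open>N\<close> and \<open>k\<close>. Such a determinant does not
  depend on the choice of the monic families. There are families with
  \<open>\<Lambda> (a\<^sub>N b\<^sub>k) = q\<^bsup>\<delta>(k-N)/2\<^esup> G\<^bsub>\<delta>+k-N\<^esub>\<close>: the row \<open>N = 0\<close> is a Bailey-type argument, and the
  three-term recurrences of \<open>a\<^sub>N\<close> and \<open>b\<^sub>k\<close> match \<open>G\<^sub>m = G\<^bsub>m+1\<^esub> + q\<^bsup>m+1\<^esup> G\<^bsub>m+2\<^esub>\<close>. For \<open>B\<^sub>n\<close> the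
  functional for \<open>\<delta> = 0\<close> is used with the extra factor \<open>2 - u\<close>.
\<close>

section \<open>Gaussian sums and the Durfee square identity\<close>

text \<open>Extending \<open>1/(q)\<^sub>s\<close> by 0 to negative \<open>s\<close> lets all sums run over the integers and be shifted freely.\<close>

definition rqfac :: "complex \<Rightarrow> int \<Rightarrow> complex" where
  "rqfac q s = (if s < 0 then 0 else 1 / qfac q (nat s))"

section \<open>Absolutely convergent sums over the integers\<close>

lemma power_int_add_nz: "(h::complex) \<noteq> 0 \<Longrightarrow> h powi a * h powi b = h powi (a + b)"
  by (simp add: power_int_add)

lemma summable_on_power_int_abs:
  fixes x :: real
  assumes "0 < x" "x < 1"
  shows "(\<lambda>s::int. x powi \<bar>s\<bar>) summable_on UNIV"
proof -
  have s: "(\<lambda>n::nat. x ^ n) summable_on UNIV"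
    using assms by (subst summable_on_UNIV_nonneg_real_iff) auto
  have 1: "(\<lambda>s::int. x powi \<bar>s\<bar>) summable_on (range int)"
    using s by (subst summable_on_reindex) (auto simp: o_def)
  have 2: "(\<lambda>s::int. x powi \<bar>s\<bar>) summable_on (range (\<lambda>n. - int n))"
    using s by (subst summable_on_reindex) (auto simp: o_def inj_on_def)
  have "range int \<union> range (\<lambda>n. - int n) = UNIV"
  proof -
    have "s \<in> range int \<union> range (\<lambda>n. - int n)" for s :: int
      by (cases s rule: int_cases2) auto
    then show ?thesis by auto
  qed
  with summable_on_union[OF 1 2] show ?thesis by simp
qed

text \<open>The quadratic exponent is at least \<open>\<bar>s\<bar> - K\<close> for a constant
  \<open>K\<close>, so a two-sided geometric series dominates.\<close>

lemma abs_summable_gauss: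
  fixes h :: complex
  assumes "0 < norm h" "norm h < 1" "a \<ge> 1"
  shows "(\<lambda>s::int. h powi (a * s\<^sup>2 + b * s)) abs_summable_on UNIV"
proof -
  define x where "x = norm h"
  have x: "0 < x" "x < 1" using assms by (auto simp: x_def)
  \<comment> \<open>With this \<open>K\<close>, four times the worst case
    \<open>s\<^sup>2 - \<bar>b\<bar> \<bar>s\<bar> - \<bar>s\<bar> + K\<close> is a square plus
    three times a square.\<close>
  define K where "K = (\<bar>b\<bar> + 1)\<^sup>2"
  have le: "\<bar>s\<bar> - K \<le> a * s\<^sup>2 + b * s" for s
  proof -
    have 0: "(2 * \<bar>s\<bar> - (\<bar>b\<bar> + 1))\<^sup>2 \<ge> 0" by simp
    have 1: "a * s\<^sup>2 \<ge> s\<^sup>2" using assms(3) by (simp add: mult_le_cancel_right1)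
    have 2: "b * s \<ge> - (\<bar>b\<bar> * \<bar>s\<bar>)" using abs_ge_minus_self[of "b * s"] by (simp add: abs_mult)
    have 4: "(\<bar>b\<bar>+1)^2 \<ge> 0" by simp
    have 3: "4 * s\<^sup>2 - 4 * (\<bar>b\<bar> * \<bar>s\<bar> + \<bar>s\<bar>) + 4 * K \<ge> 0"
    proof -
      have "4 * s\<^sup>2 - 4 * (\<bar>b\<bar> * \<bar>s\<bar> + \<bar>s\<bar>) + 4 * K = (2 * \<bar>s\<bar> - (\<bar>b\<bar> + 1))\<^sup>2 + 3 * (\<bar>b\<bar>+1)^2"
        unfolding K_def by (cases "s \<ge> 0") (simp_all add: power2_eq_square algebra_simps)
      then show ?thesis using 0 4 by simp
    qed
    define y where "y = \<bar>b\<bar> * \<bar>s\<bar>"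
    show ?thesis using 1 2 3 unfolding y_def[symmetric] by presburger
  qed
  have "(\<lambda>s::int. x powi (- K) * x powi \<bar>s\<bar>) summable_on UNIV"
    by (intro summable_on_cmult_right summable_on_power_int_abs x)
  then show ?thesis
  proof (rule abs_summable_on_comparison_test', goal_cases)
    case (1 s)
    have "x powi (a * s\<^sup>2 + b * s) \<le> x powi (\<bar>s\<bar> - K)"
      using x le by (intro power_int_decreasing) auto
    also have "\<dots> = x powi (- K) * x powi \<bar>s\<bar>"
      using x by (simp flip: power_int_add)
    finally show ?case by (simp add: norm_power_int x_def)
  qed
qed

lemma abs_summable_prod:
  fixes f g :: "_ \<Rightarrow> complex"
  assumes "f abs_summable_on A" and "g abs_summable_on B"
  shows "(\<lambda>(a, b). f a * g b) abs_summable_on A \<times> B"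
proof (rule summable_on_SigmaI)
  show "((\<lambda>b. norm (case (a, b) of (a, b) \<Rightarrow> f a * g b)) has_sum
      norm (f a) * infsum (\<lambda>b. norm (g b)) B) B" for a
    using has_sum_cmult_right[OF has_sum_infsum[OF assms(2)]] by (simp add: norm_mult)
  show "(\<lambda>a. norm (f a) * infsum (\<lambda>b. norm (g b)) B) summable_on A"
    by (rule summable_on_cmult_left[OF assms(1)])
qed auto

lemma has_sum_prod_abs:
  fixes f g :: "_ \<Rightarrow> complex"
  assumes "f abs_summable_on A" and f: "(f has_sum s) A"
    and "g abs_summable_on B" and g: "(g has_sum t) B"
  shows "((\<lambda>(a, b). f a * g b) has_sum s * t) (A \<times> B)"
proof (rule has_sum_SigmaI)
  show "((\<lambda>b. case (a, b) of (a, b) \<Rightarrow> f a * g b) has_sum f a * t) B" for a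
    using has_sum_cmult_right[OF g] by simp
  show "((\<lambda>a. f a * t) has_sum s * t) A"
    by (rule has_sum_cmult_left[OF f])
  show "(\<lambda>(a, b). f a * g b) summable_on A \<times> B"
    by (rule abs_summable_summable[OF abs_summable_prod[OF assms(1,3)]])
qed

section \<open>Finite and infinite q-products\<close>

locale nome =
  fixes q :: complex
  assumes q_nz: "0 < norm q" and q_lt_1: "norm q < 1"
begin

lemma q_neq_0 [simp]: "q \<noteq> 0" using q_nz by auto

lemma power_neq_1: "n > 0 \<Longrightarrow> q ^ n \<noteq> 1"
proof
  assume "n > 0" "q ^ n = 1"
  then have "norm q ^ n = 1" by (metis norm_one norm_power)
  moreover have "norm q ^ n < 1" using q_lt_1 \<open>n > 0\<close> by (simp add: power_less_one_iff)
  ultimately show False by simp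
qed

lemma qfac_Suc: "qfac q (Suc n) = qfac q n * (1 - q ^ Suc n)"
  by (simp add: qfac_def)

lemma qfac_neq_0: "qfac q n \<noteq> 0"
proof (induction n)
  case (Suc n)
  have "1 - q ^ Suc n \<noteq> 0" using power_neq_1[of "Suc n"] by auto
  with Suc show ?case unfolding qfac_Suc by (metis mult_eq_0_iff)
qed (simp add: qfac_def)

text \<open>The zero convention makes this hold at every integer: at \<open>s = 0\<close> the factor
  \<open>1 - q powi 0\<close> vanishes and matches \<open>rqfac q (- 1) = 0\<close>.\<close>

lemma rqfac_step: "(1 - q powi s) * rqfac q s = rqfac q (s - 1)"
proof (cases "s \<le> 0")
  case True
  then show ?thesis by (cases "s = 0") (auto simp: rqfac_def)
next
  case False
  define n where "n = nat (s - 1)"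
  have s: "s = int (Suc n)" using False by (simp add: n_def)
  have "1 - q ^ Suc n \<noteq> 0" using power_neq_1[of "Suc n"] by auto
  then have "(1 - q ^ Suc n) * rqfac q s = rqfac q (s - 1)"
    using qfac_neq_0[of n] unfolding s rqfac_def
    by (simp add: qfac_Suc divide_simps del: power_Suc of_nat_Suc) (auto simp: nat_add_distrib field_simps)
  moreover have "q powi s = q ^ Suc n" unfolding s by (rule power_int_of_nat)
  ultimately show ?thesis by simp
qed

lemma qpoch_factor_summable: "summable (\<lambda>i. norm (z * q ^ i))"
  using q_lt_1 by (simp add: norm_mult norm_power)

lemma qpoch_convergent: "convergent_prod (\<lambda>i. 1 - z * q ^ i)"
proof -
  have "summable (\<lambda>i. norm ((1 - z * q ^ i) - 1))"
    using qpoch_factor_summable[of z] by simp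
  then show ?thesis
    by (intro abs_convergent_prod_imp_convergent_prod summable_imp_abs_convergent_prod)
qed

lemma qpoch_LIMSEQ: "(\<lambda>n. \<Prod>i<n. 1 - z * q ^ i) \<longlonglongrightarrow> qpoch_inf z q"
proof -
  have "(\<lambda>n. \<Prod>i\<le>n. 1 - z * q ^ i) \<longlonglongrightarrow> qpoch_inf z q"
    unfolding qpoch_inf_def by (rule convergent_prod_LIMSEQ[OF qpoch_convergent])
  then have "(\<lambda>n. \<Prod>i<Suc n. 1 - z * q ^ i) \<longlonglongrightarrow> qpoch_inf z q"
    by (simp only: lessThan_Suc_atMost)
  then show ?thesis by (rule LIMSEQ_imp_Suc)
qed

lemma qpoch_q_neq_0: "qpoch_inf q q \<noteq> 0"
  unfolding qpoch_inf_def
proof (rule prodinf_nonzero[OF qpoch_convergent])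
  show "1 - q * q ^ i \<noteq> 0" for i using power_neq_1[of "Suc i"] by auto
qed

lemma qfac_LIMSEQ: "(\<lambda>n. qfac q n) \<longlonglongrightarrow> qpoch_inf q q"
proof -
  have "qfac q n = (\<Prod>i<n. 1 - q * q ^ i)" for n
    by (induction n) (simp_all add: qfac_Suc, simp add: qfac_def)
  then show ?thesis using qpoch_LIMSEQ[of q] by simp
qed

lemma rqfac_LIMSEQ: "(\<lambda>n. rqfac q (int n)) \<longlonglongrightarrow> 1 / qpoch_inf q q"
  using tendsto_divide[OF tendsto_const qfac_LIMSEQ qpoch_q_neq_0, of 1] by (simp add: rqfac_def)

text \<open>A convergent sequence is bounded. The uniform bound lets series containing q-factorials
  be dominated by purely Gaussian ones.\<close>

lemma rqfac_bounded: obtains C where "C > 0" "\<And>s. norm (rqfac q s) \<le> C"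
proof -
  have "Bseq (\<lambda>n. rqfac q (int n))"
    using rqfac_LIMSEQ convergent_def convergent_imp_Bseq by blast
  then obtain C where C: "C > 0" "\<And>n. norm (rqfac q (int n)) \<le> C"
    by (auto simp: Bseq_def)
  have "norm (rqfac q s) \<le> C" for s
  proof (cases "s < 0")
    case True then show ?thesis using C by (simp add: rqfac_def)
  next
    case False then show ?thesis using C(2)[of "nat s"] by simp
  qed
  with C(1) that show ?thesis by blast
qed

lemma abs_summable_gauss_rqfac2:
  "(\<lambda>s::int. q powi (s\<^sup>2 + b * s) * rqfac q (s + c) * rqfac q (s + d)) abs_summable_on UNIV"
proof -
  obtain C where C: "C > 0" "\<And>s. norm (rqfac q s) \<le> C" using rqfac_bounded by blast
  have "(\<lambda>s::int. norm (q powi (1 * s\<^sup>2 + b * s)) * (C * C)) summable_on UNIV"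
    by (intro summable_on_cmult_left abs_summable_gauss q_nz q_lt_1) auto
  then show ?thesis
  proof (rule abs_summable_on_comparison_test', goal_cases)
    case (1 s)
    have "norm (rqfac q (s + c)) * norm (rqfac q (s + d)) \<le> C * C"
      by (intro mult_mono C) (use C in auto)
    then show ?case by (simp add: norm_mult mult.assoc mult_left_mono)
  qed
qed

lemma abs_summable_gauss_rqfac:
  "(\<lambda>s::int. q powi (s\<^sup>2 + b * s) * rqfac q s) abs_summable_on UNIV"
proof -
  obtain C where C: "C > 0" "\<And>s. norm (rqfac q s) \<le> C" using rqfac_bounded by blast
  have "(\<lambda>s::int. norm (q powi (1 * s\<^sup>2 + b * s)) * C) summable_on UNIV"
    by (intro summable_on_cmult_left abs_summable_gauss q_nz q_lt_1) auto
  then show ?thesis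
    by (rule abs_summable_on_comparison_test') (use C in \<open>simp add: norm_mult mult_left_mono\<close>)
qed

lemmas summable_gauss_rqfac2 = abs_summable_summable[OF abs_summable_gauss_rqfac2]

text \<open>For \<open>c \<ge> 0\<close> this is the Durfee rectangle series: it sorts all
  partitions by the largest \<open>s\<close> by \<open>s + c\<close> rectangle in their diagram,
  which explains the value found in \<open>durfee_eq\<close>.\<close>

definition durfee :: "int \<Rightarrow> complex" where
  "durfee c = (\<Sum>\<^sub>\<infinity>s. q powi (s\<^sup>2 + c * s) * rqfac q s * rqfac q (s + c))"

lemma durfee_has_sum:
  "((\<lambda>s. q powi (s\<^sup>2 + c * s) * rqfac q s * rqfac q (s + c)) has_sum durfee c) UNIV"
  unfolding durfee_def using has_sum_infsum[OF summable_gauss_rqfac2[of c 0 c]] by simp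

text \<open>By the recurrence, consecutive differences satisfy \<open>d\<^sub>c = - q\<^bsup>c+1\<^esup> d\<^bsub>c+1\<^esub>\<close>, and \<open>d\<^sub>c\<close> tends to 0; hence
  the sum is independent of \<open>c\<close>.\<close>

lemma durfee_rec: "durfee c - durfee (c + 1) = - (q powi (c + 1)) * (durfee (c + 1) - durfee (c + 2))"
proof -
  define f1 where "f1 = (\<lambda>s. q powi (s\<^sup>2 + (c+1) * s) * rqfac q s * rqfac q (s + (c+1)))"
  define f2 where "f2 = (\<lambda>s. q powi (s\<^sup>2 + (c+2) * s) * rqfac q s * rqfac q (s + (c+2)))"
  have "((\<lambda>s. q powi (c+1) * f2 s) has_sum q powi (c+1) * durfee (c+2)) UNIV"
    unfolding f2_def by (intro has_sum_cmult_right durfee_has_sum)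
  then have f2: "((\<lambda>s. q powi (c+1) * f2 (s - 1)) has_sum q powi (c+1) * durfee (c+2)) UNIV"
    by (subst has_sum_reindex_bij_witness[where i="\<lambda>s. s + 1" and j="\<lambda>s. s - 1" and T=UNIV
          and h = "\<lambda>s. q powi (c+1) * f2 s"]) auto
  have f1: "((\<lambda>s. (1 - q powi (c+1)) * f1 s) has_sum (1 - q powi (c+1)) * durfee (c+1)) UNIV"
    unfolding f1_def by (intro has_sum_cmult_right durfee_has_sum)
  \<comment> \<open>Split \<open>1 - q^(s+c+1) = q^s (1 - q^(c+1)) + (1 - q^s)\<close>. The last
    factor lowers the index of \<open>rqfac q s\<close>, and the shift of \<open>s\<close> by one
    turns that part into \<open>f2\<close>.\<close>
  have eq: "q powi (s\<^sup>2 + c * s) * rqfac q s * rqfac q (s + c)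
      = (1 - q powi (c+1)) * f1 s + q powi (c+1) * f2 (s - 1)" for s
  proof -
    have 1: "rqfac q (s + c) = (1 - q powi (s + c + 1)) * rqfac q (s + c + 1)"
      using rqfac_step[of "s + c + 1"] by simp
    have 2: "rqfac q (s - 1) = (1 - q powi s) * rqfac q s"
      using rqfac_step[of s] by simp
    have 3: "q powi (s\<^sup>2 + (c+1) * s) = q powi (s\<^sup>2 + c * s) * q powi s"
            "q powi (s + c + 1) = q powi (c+1) * q powi s"
      by (simp_all add: power_int_add_nz algebra_simps)
    have 4: "f2 (s - 1) = q powi ((s - 1)\<^sup>2 + (c+2) * (s-1)) * rqfac q (s - 1) * rqfac q (s + c + 1)"
      by (simp add: f2_def algebra_simps)
    have 5: "q powi (c+1) * q powi ((s - 1)\<^sup>2 + (c+2) * (s-1)) = q powi (s\<^sup>2 + c * s)"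
      by (simp add: power_int_add_nz algebra_simps power2_eq_square)
    have 6: "q powi (c+1) * f2 (s - 1) = q powi (s\<^sup>2 + c * s) * rqfac q (s - 1) * rqfac q (s + c + 1)"
      unfolding 4 5[symmetric] by (simp only: mult.assoc)
    show ?thesis unfolding 6 f1_def 1 2 3 by (simp add: algebra_simps)
  qed
  have "durfee c = (1 - q powi (c+1)) * durfee (c+1) + q powi (c+1) * durfee (c+2)"
    using has_sum_add[OF f1 f2] durfee_has_sum[of c] unfolding eq by (rule has_sum_unique[rotated])
  then show ?thesis by (simp add: algebra_simps)
qed

text \<open>The term at \<open>s = 0\<close> is \<open>rqfac q (int n)\<close>, terms at negative
  \<open>s\<close> vanish, and every term at \<open>s \<ge> 1\<close> carries
  \<open>q^(n s)\<close>, hence a factor of size at most \<open>norm q ^ n\<close>.\<close>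

lemma durfee_bound:
  obtains B where "B > 0" "\<And>n. norm (durfee (int n) - rqfac q (int n)) \<le> B * norm q ^ n"
proof -
  obtain C where C: "C > 0" "\<And>s. norm (rqfac q s) \<le> C" using rqfac_bounded by blast
  define g where "g = (\<lambda>s::int. norm (q powi (s\<^sup>2)) * (C * C))"
  have gs: "g summable_on UNIV" unfolding g_def
    using abs_summable_gauss[OF q_nz q_lt_1, of 1 0] by (intro summable_on_cmult_left) auto
  define B where "B = infsum g UNIV + 1"
  have g0: "g s \<ge> 0" for s using C by (simp add: g_def)
  have B: "B > 0" unfolding B_def using infsum_nonneg[of UNIV g] g0 by (simp add: add_nonneg_pos)
  have "norm (durfee (int n) - rqfac q (int n)) \<le> B * norm q ^ n" for n
  proof -
    define f where "f = (\<lambda>s. q powi (s\<^sup>2 + int n * s) * rqfac q s * rqfac q (s + int n))"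
    have "(f has_sum durfee (int n)) (UNIV - {0} \<union> {0})"
      unfolding f_def using durfee_has_sum[of "int n"] by (simp add: insert_absorb)
    moreover have "(f has_sum f 0) {0}" by (rule has_sum_finiteI) auto
    ultimately have d: "(f has_sum durfee (int n) - f 0) (UNIV - {0})"
      by (intro has_sum_Diff) (simp_all add: insert_absorb)
    have f0: "f 0 = rqfac q (int n)" by (simp add: f_def rqfac_def qfac_def)
    have gs': "(\<lambda>s. g s * norm q ^ n) summable_on (UNIV - {0})"
      by (rule summable_on_subset_banach[OF summable_on_cmult_left[OF gs]]) auto
    have le: "norm (f s) \<le> g s * norm q ^ n" if "s \<noteq> 0" for s
    proof (cases "s < 0")
      case True then show ?thesis using g0 by (simp add: f_def rqfac_def)
    next
      case False
      have m1: "norm (rqfac q s) * norm (rqfac q (s + int n)) \<le> C * C"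
        by (intro mult_mono C) (use C in auto)
      have m2: "norm (q powi (s\<^sup>2 + int n * s)) \<le> norm (q powi (s\<^sup>2)) * norm q ^ n"
      proof -
        have "norm q powi (int n * s) \<le> norm q powi (int n)"
          using q_nz q_lt_1 False that by (intro power_int_decreasing) (auto simp: mult_le_cancel_left1)
        then show ?thesis by (simp add: power_int_add norm_mult norm_power_int mult_left_mono)
      qed
      have "norm (q powi (s\<^sup>2 + int n * s)) * (norm (rqfac q s) * norm (rqfac q (s + int n)))
          \<le> (norm (q powi (s\<^sup>2)) * norm q ^ n) * (C * C)"
        by (intro mult_mono[OF m2 m1]) auto
      then show ?thesis by (simp add: f_def g_def norm_mult mult_ac)
    qed
    have "norm (durfee (int n) - f 0) \<le> infsum (\<lambda>s. g s * norm q ^ n) (UNIV - {0})"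
      using norm_infsum_le[OF d has_sum_infsum[OF gs']] le by auto
    also have "\<dots> \<le> infsum (\<lambda>s. g s * norm q ^ n) UNIV"
      by (rule infsum_mono_neutral[OF gs' summable_on_cmult_left[OF gs]]) (use g0 in auto)
    also have "\<dots> = infsum g UNIV * norm q ^ n" by (rule infsum_cmult_left) (use gs in auto)
    also have "\<dots> \<le> B * norm q ^ n" unfolding B_def by (intro mult_right_mono) auto
    finally show ?thesis unfolding f0 .
  qed
  with B that show ?thesis by blast
qed

lemma durfee_LIMSEQ: "(\<lambda>n. durfee (int n)) \<longlonglongrightarrow> 1 / qpoch_inf q q"
proof -
  obtain B where B: "B > 0" "\<And>n. norm (durfee (int n) - rqfac q (int n)) \<le> B * norm q ^ n"
    using durfee_bound by blast
  have "(\<lambda>n. B * norm q ^ n) \<longlonglongrightarrow> B * 0"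
    using q_lt_1 by (intro tendsto_intros LIMSEQ_power_zero) auto
  then have "(\<lambda>n. B * norm q ^ n) \<longlonglongrightarrow> 0" by simp
  then have "(\<lambda>n. durfee (int n) - rqfac q (int n)) \<longlonglongrightarrow> 0"
    by (intro Lim_null_comparison[OF always_eventually[OF allI[OF B(2)]]])
  from tendsto_add[OF this rqfac_LIMSEQ] show ?thesis by simp
qed

lemma durfee_eq: "durfee c = 1 / qpoch_inf q q"
proof -
  define d where "d c = durfee c - durfee (c + 1)" for c
  have d_rec: "d c = - (q powi (c + 1)) * d (c + 1)" for c
    unfolding d_def using durfee_rec[of c] by (simp add: add.assoc)
  have dlim: "(\<lambda>n. d (int n)) \<longlonglongrightarrow> 0"
    using tendsto_diff[OF durfee_LIMSEQ LIMSEQ_Suc[OF durfee_LIMSEQ]] by (simp add: d_def add.commute)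
  have d_nat: "d (int n) = 0" for n
  proof -
    \<comment> \<open>For \<open>c \<ge> 0\<close> the factor in \<open>d_rec\<close> has norm at
      most 1, so the norms of \<open>d\<close> cannot decrease along the naturals. As they tend to
      0, all of them are 0.\<close>
    have dec: "norm (d (int n)) \<le> norm (d (int (m + n)))" for m
    proof (induction m)
      case (Suc m)
      have "norm (d (int (m + n))) = norm q powi (int (m + n) + 1) * norm (d (int (Suc m + n)))"
        by (subst d_rec) (simp add: norm_mult norm_power_int add_ac)
      also have "\<dots> \<le> 1 * norm (d (int (Suc m + n)))"
        using q_nz q_lt_1 by (intro mult_right_mono power_int_le_one) auto
      finally show ?case using Suc by simp
    qed simp
    have "(\<lambda>m. norm (d (int (m + n)))) \<longlonglongrightarrow> norm (0::complex)"
      by (rule tendsto_norm[OF LIMSEQ_ignore_initial_segment[OF dlim]])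
    then have "norm (d (int n)) \<le> norm (0::complex)"
      using dec by (intro LIMSEQ_le_const) auto
    then show ?thesis by simp
  qed
  \<comment> \<open>For negative \<open>c\<close> the recurrence carries the zero downwards from
    \<open>d 0\<close>.\<close>
  have d0: "d c = 0" for c
  proof (cases "c \<ge> 0")
    case True then show ?thesis using d_nat[of "nat c"] by simp
  next
    case False
    then have "c \<le> 0" by simp
    then show ?thesis
    proof (induction c rule: int_le_induct)
      case base then show ?case using d_nat[of 0] by simp
    next
      case (step i) then show ?case using d_rec[of "i - 1"] by simp
    qed
  qed
  have const: "durfee c = durfee 0" for c
  proof (induction c rule: int_induct[where k=0])
    case (step1 i) then show ?case using d0[of i] by (simp add: d_def)
  next
    case (step2 i) then show ?case using d0[of "i - 1"] by (simp add: d_def)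
  qed simp
  have "(\<lambda>n. durfee (int n)) \<longlonglongrightarrow> durfee 0" by (subst const) simp
  with durfee_LIMSEQ have "durfee 0 = 1 / qpoch_inf q q" using LIMSEQ_unique by blast
  with const show ?thesis by metis
qed

end

section \<open>Euler's identity and the Jacobi triple product\<close>

context nome
begin

text \<open>The coefficient of \<open>z^n\<close> in Euler's expansion of
  \<open>qpoch_inf z q\<close>.\<close>

definition euler_coeff :: "nat \<Rightarrow> complex" where
  "euler_coeff n = (- 1) ^ n * q ^ (n choose 2) / qfac q n"

lemma euler_coeff_Suc: "euler_coeff (Suc n) * (1 - q ^ Suc n) = - (q ^ n) * euler_coeff n"
proof -
  have "1 - q ^ Suc n \<noteq> 0" using power_neq_1[of "Suc n"] by auto
  moreover have "Suc n choose 2 = n + (n choose 2)" by (simp add: numeral_2_eq_2)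
  ultimately show ?thesis
    using qfac_neq_0[of n] unfolding euler_coeff_def qfac_Suc
    by (simp add: power_add divide_simps del: power_Suc) (simp add: algebra_simps)
qed

lemma euler_summable: "summable (\<lambda>n. norm (euler_coeff n * z ^ n))"
proof -
  have "(\<lambda>n. norm q ^ n * norm z) \<longlonglongrightarrow> 0 * norm z"
    using q_lt_1 by (intro tendsto_intros LIMSEQ_power_zero) auto
  \<comment> \<open>The ratio of consecutive terms is \<open>q^n z / (1 - q^(n+1))\<close> in norm,
    and the denominator has norm at least \<open>1 - norm q\<close>; this threshold therefore forces
    a ratio of at most 1/2.\<close>
  then have "eventually (\<lambda>n. norm q ^ n * norm z < (1 - norm q) / 2) sequentially"
    using q_lt_1 by (intro order_tendstoD) auto
  then obtain N where N: "\<And>n. n \<ge> N \<Longrightarrow> norm q ^ n * norm z < (1 - norm q) / 2"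
    by (auto simp: eventually_sequentially)
  show ?thesis
  proof (rule summable_ratio_test[of "1/2" N])
    fix n assume n: "n \<ge> N"
    have "norm q ^ Suc n \<le> norm q ^ 1" using q_lt_1 by (intro power_decreasing) auto
    then have "1 - norm q \<le> norm (1 - q ^ Suc n)"
      using norm_triangle_ineq2[of 1 "q ^ Suc n"] by (simp add: norm_power del: power_Suc)
    then have "norm (euler_coeff (Suc n)) * (1 - norm q) \<le> norm (euler_coeff (Suc n)) * norm (1 - q ^ Suc n)"
      by (intro mult_left_mono) auto
    also have "\<dots> = norm q ^ n * norm (euler_coeff n)"
      by (subst norm_mult[symmetric], subst euler_coeff_Suc) (simp add: norm_mult norm_power)
    finally have "norm (euler_coeff (Suc n)) * (1 - norm q) * norm z \<le> norm q ^ n * norm (euler_coeff n) * norm z"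
      by (rule mult_right_mono) auto
    also have "\<dots> = (norm q ^ n * norm z) * norm (euler_coeff n)" by simp
    also have "\<dots> \<le> (1 - norm q) / 2 * norm (euler_coeff n)"
      using N[OF n] by (intro mult_right_mono) auto
    finally have "(1 - norm q) * (norm (euler_coeff (Suc n)) * norm z) \<le> (1 - norm q) * (1 / 2 * norm (euler_coeff n))"
      by (simp add: algebra_simps)
    then have *: "norm (euler_coeff (Suc n)) * norm z \<le> 1 / 2 * norm (euler_coeff n)"
      using q_lt_1 by (subst (asm) mult_le_cancel_left_pos) auto
    have "norm (euler_coeff (Suc n)) * norm z * norm z ^ n \<le> 1 / 2 * norm (euler_coeff n) * norm z ^ n"
      by (rule mult_right_mono[OF *]) auto
    then show "norm (norm (euler_coeff (Suc n) * z ^ Suc n)) \<le> 1/2 * norm (norm (euler_coeff n * z ^ n))"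
      by (simp add: norm_mult norm_power mult_ac)
  qed auto
qed

text \<open>The power series satisfies \<open>F z = (1 - z) * F (q * z)\<close>. Iterating produces
  the partial products, and continuity at 0 with \<open>F 0 = 1\<close> removes the remaining factor
  in the limit.\<close>

theorem euler_qpoch: "(\<lambda>n. euler_coeff n * z ^ n) sums qpoch_inf z q"
proof -
  define F where "F z = (\<Sum>n. euler_coeff n * z ^ n)" for z
  have sm: "summable (\<lambda>n. euler_coeff n * z ^ n)" for z
    by (rule summable_norm_cancel[OF euler_summable])
  then have F: "(\<lambda>n. euler_coeff n * z ^ n) sums F z" for z
    unfolding F_def by (rule summable_sums)
  have step: "F z = (1 - z) * F (q * z)" for z
  proof -
    have "(\<lambda>n. euler_coeff n * z ^ n - euler_coeff n * (q * z) ^ n) sums (F z - F (q * z))"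
      by (rule sums_diff[OF F F])
    then have "(\<lambda>n. euler_coeff (Suc n) * z ^ Suc n - euler_coeff (Suc n) * (q * z) ^ Suc n) sums (F z - F (q * z))"
      by (subst sums_Suc_iff) auto
    moreover have "euler_coeff (Suc n) * z ^ Suc n - euler_coeff (Suc n) * (q * z) ^ Suc n
      = - z * (euler_coeff n * (q * z) ^ n)" for n
    proof -
      have "euler_coeff (Suc n) * z ^ Suc n - euler_coeff (Suc n) * (q * z) ^ Suc n
        = (euler_coeff (Suc n) * (1 - q ^ Suc n)) * z ^ Suc n"
        by (simp add: power_mult_distrib algebra_simps)
      then show ?thesis unfolding euler_coeff_Suc by (simp add: power_mult_distrib)
    qed
    ultimately have "(\<lambda>n. - z * (euler_coeff n * (q * z) ^ n)) sums (F z - F (q * z))" by simp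
    moreover have "(\<lambda>n. - z * (euler_coeff n * (q * z) ^ n)) sums (- z * F (q * z))"
      by (rule sums_mult[OF F])
    ultimately have "F z - F (q * z) = - z * F (q * z)" by (rule sums_unique2)
    then show ?thesis by (simp add: algebra_simps)
  qed
  have iter: "F z = (\<Prod>i<m. 1 - z * q ^ i) * F (q ^ m * z)" for m
  proof (induction m)
    case (Suc m)
    then show ?case by (subst (asm) step) (simp add: mult_ac)
  qed simp
  have "isCont F 0"
    unfolding F_def by (rule isCont_powser_converges_everywhere) (rule sm)
  moreover have "(\<lambda>m. q ^ m * z) \<longlonglongrightarrow> 0 * z"
    using q_lt_1 by (intro tendsto_intros LIMSEQ_power_zero) auto
  ultimately have "(\<lambda>m. F (q ^ m * z)) \<longlonglongrightarrow> F 0"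
    by (intro isCont_tendsto_compose[of 0 F]) auto
  moreover have "F 0 = 1" unfolding F_def powser_zero by (simp add: euler_coeff_def qfac_def binomial_eq_0)
  ultimately have "(\<lambda>m. (\<Prod>i<m. 1 - z * q ^ i) * F (q ^ m * z)) \<longlonglongrightarrow> qpoch_inf z q * 1"
    by (intro tendsto_mult qpoch_LIMSEQ) auto
  then have "(\<lambda>m. F z) \<longlonglongrightarrow> qpoch_inf z q" by (simp flip: iter)
  then have "F z = qpoch_inf z q" by (rule LIMSEQ_const_iff[THEN iffD1])
  with F[of z] show ?thesis by simp
qed

text \<open>Summing over all integers, with \<open>rqfac\<close> killing the negative indices,
  prepares the index shift in the triple product.\<close>

lemma euler_qpoch_int:
  assumes "z \<noteq> 0"
  shows "(\<lambda>s::int. (- 1) powi s * q powi (s * (s - 1) div 2) * z powi s * rqfac q s) abs_summable_on UNIV"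
    and "((\<lambda>s::int. (- 1) powi s * q powi (s * (s - 1) div 2) * z powi s * rqfac q s) has_sum qpoch_inf z q) UNIV"
proof -
  define f where "f = (\<lambda>s::int. (- 1) powi s * q powi (s * (s - 1) div 2) * z powi s * rqfac q s)"
  have "int n * (int n - 1) div 2 = int (n choose 2)" for n
  proof (cases n)
    case (Suc m)
    then show ?thesis by (simp add: choose_two zdiv_int algebra_simps)
  qed simp
  then have f: "f \<circ> int = (\<lambda>n. euler_coeff n * z ^ n)"
    by (auto simp: f_def euler_coeff_def rqfac_def)
  have 1: "((\<lambda>n. euler_coeff n * z ^ n) has_sum qpoch_inf z q) UNIV"
    using euler_summable euler_qpoch by (rule norm_summable_imp_has_sum)
  have 2: "((\<lambda>n. norm (euler_coeff n * z ^ n))) summable_on UNIV"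
    using euler_summable[of z] by (subst summable_on_UNIV_nonneg_real_iff) auto
  have 3: "(f has_sum qpoch_inf z q) (range int)"
    using 1 by (subst has_sum_reindex) (simp_all add: f)
  have "((\<lambda>s. norm (f s)) \<circ> int) = (\<lambda>n. norm (euler_coeff n * z ^ n))"
    using f by (auto simp: fun_eq_iff)
  then have 4: "(\<lambda>s. norm (f s)) summable_on (range int)"
    using 2 by (subst summable_on_reindex) simp_all
  have neg: "f s = 0" if "s \<notin> range int" for s
    using that by (cases s rule: int_cases2) (auto simp: f_def rqfac_def)
  have "f abs_summable_on UNIV"
    by (rule iffD1[OF summable_on_cong_neutral 4]) (use neg in auto)
  then show "(\<lambda>s::int. (- 1) powi s * q powi (s * (s - 1) div 2) * z powi s * rqfac q s) abs_summable_on UNIV"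
    unfolding f_def .
  have "(f has_sum qpoch_inf z q) UNIV"
    by (rule iffD1[OF has_sum_cong_neutral 3]) (use neg in auto)
  then show "((\<lambda>s::int. (- 1) powi s * q powi (s * (s - 1) div 2) * z powi s * rqfac q s) has_sum qpoch_inf z q) UNIV"
    unfolding f_def .
qed

text \<open>Multiply Euler's expansions of \<open>qpoch_inf z q\<close> and
  \<open>qpoch_inf (q / z) q\<close> and group the terms by the difference \<open>c\<close> of the
  two indices. The inner sum is \<open>durfee c\<close>, which is the same constant for every
  \<open>c\<close>.\<close>

theorem jacobi_triple_product:
  assumes z: "z \<noteq> 0"
  shows "((\<lambda>c::int. (- 1) powi c * q powi (c * (c - 1) div 2) * z powi c) has_sum
            qpoch_inf q q * qtheta z q) UNIV"
proof -
  define f where "f = (\<lambda>z. \<lambda>s::int. (- 1) powi s * q powi (s * (s - 1) div 2) * z powi s * rqfac q s)"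
  have qz: "q / z \<noteq> 0" using z by simp
  have "((\<lambda>(a, b). f z a * f (q / z) b) has_sum qpoch_inf z q * qpoch_inf (q / z) q) (UNIV \<times> UNIV)"
    using euler_qpoch_int[OF z] euler_qpoch_int[OF qz] unfolding f_def
    by (rule has_sum_prod_abs)
  then have "((\<lambda>(c, s). f z (s + c) * f (q / z) s) has_sum qtheta z q) (UNIV \<times> UNIV)"
    unfolding qtheta_def
    by (subst has_sum_reindex_bij_witness[where i="\<lambda>(a, b). (a - b, b)" and j="\<lambda>(c, s). (s + c, s)"
          and T="UNIV \<times> UNIV" and h="\<lambda>(a, b). f z a * f (q / z) b"]) auto
  moreover have "f z (s + c) * f (q / z) s
      = (- 1) powi c * q powi (c * (c - 1) div 2) * z powi c
          * (q powi (s\<^sup>2 + c * s) * rqfac q s * rqfac q (s + c))" for c s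
  proof -
    \<comment> \<open>A product of consecutive integers is even, so \<open>div 2\<close> is exact
      and the exponents can be compared after doubling.\<close>
    have half: "2 * (x * (x - 1) div 2) = x * (x - 1)" for x :: int by simp
    have "2 * ((s + c) * (s + c - 1) div 2 + s * (s - 1) div 2 + s)
        = 2 * (c * (c - 1) div 2 + (s\<^sup>2 + c * s))"
      unfolding distrib_left half by (simp add: algebra_simps power2_eq_square)
    then have e: "(s + c) * (s + c - 1) div 2 + s * (s - 1) div 2 + s
        = c * (c - 1) div 2 + (s\<^sup>2 + c * s)" by simp
    have 1: "q powi ((s + c) * (s + c - 1) div 2) * q powi (s * (s - 1) div 2) * q powi s
        = q powi (c * (c - 1) div 2) * q powi (s\<^sup>2 + c * s)"
      by (simp only: power_int_add_nz q_neq_0 not_False_eq_True e)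
    have 2: "(- 1) powi (s + c) * (- 1) powi s = ((- 1) powi c :: complex)"
      by (simp add: power_int_add flip: power_int_mult_distrib)
    have 3: "z powi (s + c) * (q / z) powi s = z powi c * q powi s"
      using z by (simp add: power_int_add power_int_divide_distrib)
    have "f z (s + c) * f (q / z) s = ((- 1) powi (s + c) * (- 1) powi s)
       * (q powi ((s + c) * (s + c - 1) div 2) * q powi (s * (s - 1) div 2))
       * (z powi (s + c) * (q / z) powi s) * (rqfac q s * rqfac q (s + c))"
      unfolding f_def by (simp only: mult_ac)
    also have "\<dots> = (- 1) powi c * (q powi ((s + c) * (s + c - 1) div 2) * q powi (s * (s - 1) div 2) * q powi s)
        * z powi c * (rqfac q s * rqfac q (s + c))"
      unfolding 2 3 by (simp only: mult_ac)
    finally show ?thesis unfolding 1 by (simp only: mult_ac)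
  qed
  ultimately have "((\<lambda>(c, s). (- 1) powi c * q powi (c * (c - 1) div 2) * z powi c
          * (q powi (s\<^sup>2 + c * s) * rqfac q s * rqfac q (s + c))) has_sum qtheta z q) (UNIV \<times> UNIV)"
    by simp
  then have "((\<lambda>c. (- 1) powi c * q powi (c * (c - 1) div 2) * z powi c * (1 / qpoch_inf q q)) has_sum qtheta z q) UNIV"
  proof (rule has_sum_SigmaD)
    show "((\<lambda>s. case (c, s) of (c, s) \<Rightarrow> (- 1) powi c * q powi (c * (c - 1) div 2) * z powi c
          * (q powi (s\<^sup>2 + c * s) * rqfac q s * rqfac q (s + c))) has_sum
        (- 1) powi c * q powi (c * (c - 1) div 2) * z powi c * (1 / qpoch_inf q q)) UNIV" for c
      using has_sum_cmult_right[OF durfee_has_sum[of c]] unfolding durfee_eq by simp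
  qed
  from has_sum_cmult_left[OF this, of "qpoch_inf q q"] show ?thesis
    using qpoch_q_neq_0 by (simp add: mult.commute)
qed

end

section \<open>A Bailey pair\<close>

lemma minus_one_powi_simps:
  "(- 1) powi (r - 1) = - ((- 1) powi r :: complex)"
  "(- 1) powi (- r) = ((- 1) powi r :: complex)"
  "(- 1) powi (- 1 - r) = - ((- 1) powi r :: complex)"
proof -
  show 1: "(- 1) powi (r - 1) = - ((- 1) powi r :: complex)" for r by (simp add: power_int_diff)
  show 2: "(- 1) powi (- r) = ((- 1) powi r :: complex)" for r
    by (simp add: power_int_minus flip: power_int_inverse)
  show "(- 1) powi (- 1 - r) = - ((- 1) powi r :: complex)"
    using 1[of "- r"] unfolding 2 by (metis minus_diff_commute)
qed

text \<open>The monic solution of \<open>p_(k+1) = (x - a_k) p_k - b_k p_(k-1)\<close>. Putting the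
  polynomial families of the functional into this form yields their degrees and leading coefficients
  in one lemma.\<close>

fun three_term_poly :: "(nat \<Rightarrow> 'a) \<Rightarrow> (nat \<Rightarrow> 'a) \<Rightarrow> nat \<Rightarrow> 'a::comm_ring_1 poly" where
  "three_term_poly a b 0 = 1"
| "three_term_poly a b (Suc 0) = [:- a 0, 1:]"
| "three_term_poly a b (Suc (Suc k)) = [:- a (Suc k), 1:] * three_term_poly a b (Suc k) - smult (b (Suc k)) (three_term_poly a b k)"

locale sqrt_nome = nome q for q :: complex +
  fixes h :: complex
  assumes h_sq: "h\<^sup>2 = q"
begin

lemma h_neq_0 [simp]: "h \<noteq> 0" using h_sq q_neq_0 by auto

lemma norm_h: "0 < norm h" "norm h < 1"
proof -
  have "norm h ^ 2 < 1 ^ 2" using q_lt_1 h_sq by (simp flip: norm_power)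
  then show "norm h < 1" by (rule power_less_imp_less_base) simp
qed simp

lemma q_powi: "q powi k = h powi (2 * k)"
  unfolding h_sq[symmetric] by (simp add: power_int_power)

lemma h_add: "h powi a * h powi b = h powi (a + b)"
  by (simp add: power_int_add)

lemma h_add': "h powi a * (h powi b * x) = h powi (a + b) * x"
  by (simp add: power_int_add)

text \<open>With \<open>X\<^sub>r = h\<^bsup>2r+d\<^esup>\<close>, the argument \<open>sym_arg d r\<close> is \<open>X\<^sub>r + 1/X\<^sub>r\<close>; the parameter \<open>d\<close> is the paper's
  \<open>\<delta>\<close>.\<close>

definition sym_arg :: "nat \<Rightarrow> int \<Rightarrow> complex" where
  "sym_arg d r = h powi (2 * r + int d) + h powi (- (2 * r + int d))"

section \<open>Weights and finite Bailey sums\<close>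

definition bailey_weight :: "nat \<Rightarrow> int \<Rightarrow> complex" where
  "bailey_weight d r = (- 1) powi r * h powi (3 * r\<^sup>2 - r + 2 * int d * r)"

definition theta_weight :: "nat \<Rightarrow> int \<Rightarrow> complex" where
  "theta_weight d r = (- 1) powi r * h powi (5 * r\<^sup>2 - r + 4 * int d * r)"

text \<open>The extra factor comes from \<open>L\<^sup>2 + d L = (L - r)\<^sup>2 + (2 r + d) (L - r)
  + r\<^sup>2 + d r\<close>, used when a sum over \<open>L\<close> is turned into a Durfee
  series.\<close>

lemma theta_weight_eq_bailey_weight: "theta_weight d r = bailey_weight d r * q powi (r\<^sup>2 + int d * r)"
  unfolding theta_weight_def bailey_weight_def q_powi by (simp add: mult.assoc h_add algebra_simps)

text \<open>The beta side of a two-sided Bailey pair, with a test function \<open>f\<close>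
  inserted. The range is exactly where both q-factorials have non-negative index.\<close>

definition bailey_sum :: "nat \<Rightarrow> int \<Rightarrow> (int \<Rightarrow> complex) \<Rightarrow> complex" where
  "bailey_sum d L f = (\<Sum>r\<in>{- L - int d..L}. bailey_weight d r * f r * rqfac q (L - r) * rqfac q (L + r + int d))"

lemma bailey_sum_add: "bailey_sum d L (\<lambda>r. f r + g r) = bailey_sum d L f + bailey_sum d L g"
  by (simp add: bailey_sum_def algebra_simps sum.distrib)

lemma bailey_sum_diff: "bailey_sum d L (\<lambda>r. f r - g r) = bailey_sum d L f - bailey_sum d L g"
  by (simp add: bailey_sum_def algebra_simps sum_subtractf)

lemma bailey_sum_cmult: "bailey_sum d L (\<lambda>r. c * f r) = c * bailey_sum d L f"
  by (simp add: bailey_sum_def sum_distrib_left mult_ac)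

lemmas bailey_sum_linear = bailey_sum_add bailey_sum_diff bailey_sum_cmult

lemma h_powi_sym_arg: "q powi L * h powi int d * sym_arg d r = q powi (L - r) + q powi (L + r + int d)"
  unfolding sym_arg_def q_powi distrib_left
  by (simp add: mult.assoc h_add h_add' algebra_simps del: power_int_of_nat)

text \<open>Comes from \<open>(1 - q\<^bsup>L-r\<^esup>) (1 - q\<^bsup>L+r+d\<^esup>) = 1 + q\<^bsup>2L+d\<^esup> - q\<^sup>L h\<^sup>d (X\<^sub>r + 1/X\<^sub>r)\<close>.\<close>

lemma bailey_sum_rec:
  "bailey_sum d (L - 1) f = (1 + q powi (2 * L + int d)) * bailey_sum d L f
     - q powi L * h powi int d * bailey_sum d L (\<lambda>r. sym_arg d r * f r)"
proof -
  have z: "rqfac q (- 1) = 0" by (simp add: rqfac_def)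
  \<comment> \<open>The range for \<open>L - 1\<close> may be enlarged to that for \<open>L\<close>,
    because each new endpoint brings a factor \<open>rqfac q (- 1) = 0\<close>.\<close>
  have "bailey_sum d (L - 1) f = (\<Sum>r\<in>{- L - int d..L}.
      bailey_weight d r * f r * rqfac q (L - 1 - r) * rqfac q (L - 1 + r + int d))"
    unfolding bailey_sum_def
  proof (rule sum.mono_neutral_left)
    show "\<forall>r\<in>{- L - int d..L} - {- (L - 1) - int d..L - 1}.
       bailey_weight d r * f r * rqfac q (L - 1 - r) * rqfac q (L - 1 + r + int d) = 0"
    proof
      fix r assume "r \<in> {- L - int d..L} - {- (L - 1) - int d..L - 1}"
      then have "r = L \<or> r = - L - int d" by auto
      then show "bailey_weight d r * f r * rqfac q (L - 1 - r) * rqfac q (L - 1 + r + int d) = 0"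
        using z by auto
    qed
  qed auto
  also have "\<dots> = bailey_sum d L (\<lambda>r. (1 - q powi (L - r)) * (1 - q powi (L + r + int d)) * f r)"
    unfolding bailey_sum_def
  proof (rule sum.cong[OF refl])
    fix r
    have "rqfac q (L - 1 - r) = (1 - q powi (L - r)) * rqfac q (L - r)"
         "rqfac q (L - 1 + r + int d) = (1 - q powi (L + r + int d)) * rqfac q (L + r + int d)"
      using rqfac_step[of "L - r"] rqfac_step[of "L + r + int d"] by (simp_all add: algebra_simps)
    then show "bailey_weight d r * f r * rqfac q (L - 1 - r) * rqfac q (L - 1 + r + int d) =
       bailey_weight d r * ((1 - q powi (L - r)) * (1 - q powi (L + r + int d)) * f r) *
         rqfac q (L - r) * rqfac q (L + r + int d)" by simp
  qed
  also have "(\<lambda>r. (1 - q powi (L - r)) * (1 - q powi (L + r + int d)) * f r) =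
     (\<lambda>r. (1 + q powi (2 * L + int d)) * f r - q powi L * h powi int d * (sym_arg d r * f r))"
  proof
    fix r
    have "q powi (L - r) * q powi (L + r + int d) = q powi (2 * L + int d)"
      by (simp add: power_int_add_nz)
    then have E: "(1 - q powi (L - r)) * (1 - q powi (L + r + int d))
       = 1 + q powi (2 * L + int d) - q powi L * h powi int d * sym_arg d r"
      unfolding h_powi_sym_arg by (simp add: algebra_simps)
    show "(1 - q powi (L - r)) * (1 - q powi (L + r + int d)) * f r =
      (1 + q powi (2 * L + int d)) * f r - q powi L * h powi int d * (sym_arg d r * f r)"
      unfolding E by (simp only: left_diff_distrib distrib_right mult.assoc)
  qed
  finally show ?thesis by (simp only: bailey_sum_linear)
qed

text \<open>The substitution \<open>r \<mapsto> - d - r\<close> preserves the range, exchanges the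
  two q-factorials and changes the weight by the displayed sign and power of
  \<open>q\<close>.\<close>

lemma bailey_sum_reflect:
  "bailey_sum d L f = (- 1) ^ d * bailey_sum d L (\<lambda>r. q powi (r + int d * (r + 1)) * f (- int d - r))" if "d \<le> 1"
proof -
  have "bailey_sum d L f = (\<Sum>r\<in>{- L - int d..L}. bailey_weight d (- int d - r) * f (- int d - r)
      * rqfac q (L - (- int d - r)) * rqfac q (L + (- int d - r) + int d))"
    unfolding bailey_sum_def
    by (rule sum.reindex_bij_witness[where i="\<lambda>r. - int d - r" and j="\<lambda>r. - int d - r"]) auto
  also have "\<dots> = (- 1) ^ d * bailey_sum d L (\<lambda>r. q powi (r + int d * (r + 1)) * f (- int d - r))"
    unfolding bailey_sum_def sum_distrib_left
  proof (rule sum.cong[OF refl])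
    fix r
    have d: "d = 0 \<or> d = 1" using that by auto
    have "bailey_weight d (- int d - r) = (- 1) ^ d * (bailey_weight d r * q powi (r + int d * (r + 1)))"
      using d unfolding bailey_weight_def q_powi
      by (auto simp: mult.assoc h_add minus_one_powi_simps) (simp_all add: algebra_simps power2_eq_square)
    moreover have "rqfac q (L - (- int d - r)) = rqfac q (L + r + int d)"
      "rqfac q (L + (- int d - r) + int d) = rqfac q (L - r)"
      by (simp_all add: algebra_simps)
    ultimately show "bailey_weight d (- int d - r) * f (- int d - r)
      * rqfac q (L - (- int d - r)) * rqfac q (L + (- int d - r) + int d) =
      (- 1) ^ d * (bailey_weight d r * (q powi (r + int d * (r + 1)) * f (- int d - r)) * rqfac q (L - r) * rqfac q (L + r + int d))"
      by (simp only: mult_ac)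
  qed
  finally show ?thesis .
qed

lemma sum_telescope_int:
  fixes G :: "int \<Rightarrow> complex"
  assumes "a \<le> b + 1"
  shows "(\<Sum>r\<in>{a..b}. G r - G (r - 1)) = G b - G (a - 1)"
proof -
  have "a - 1 \<le> b" using assms by simp
  then show ?thesis
  proof (induction b rule: int_ge_induct)
    case (step b)
    have "{a..b + 1} = insert (b + 1) {a..b}" using step by auto
    then show ?case using step by simp
  qed simp
qed

text \<open>The weighted summand is \<open>G r - G (r - 1)\<close> for the \<open>G\<close> of the
  proof, and \<open>G\<close> vanishes at both ends since a q-factorial there has index -1.\<close>

lemma bailey_sum_telescope:
  assumes "L \<ge> 0"
  shows "bailey_sum d L (\<lambda>r. q powi ((2 + int d) * r + 2 * int d) * (1 - q powi (L - r))
            + q powi (int d * r - r) * (1 - q powi (L + r + int d))) = 0"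
proof -
  define G where "G r = bailey_weight d r * q powi ((2 + int d) * r + 2 * int d)
      * rqfac q (L - r - 1) * rqfac q (L + r + int d)" for r
  have z: "rqfac q (- 1) = 0" by (simp add: rqfac_def)
  have "bailey_sum d L (\<lambda>r. q powi ((2 + int d) * r + 2 * int d) * (1 - q powi (L - r))
            + q powi (int d * r - r) * (1 - q powi (L + r + int d)))
      = (\<Sum>r\<in>{- L - int d..L}. G r - G (r - 1))"
    unfolding bailey_sum_def
  proof (rule sum.cong[OF refl])
    fix r
    have 1: "rqfac q (L - r - 1) = (1 - q powi (L - r)) * rqfac q (L - r)"
         "rqfac q (L + (r - 1) + int d) = (1 - q powi (L + r + int d)) * rqfac q (L + r + int d)"
      using rqfac_step[of "L - r"] rqfac_step[of "L + r + int d"] by (simp_all add: algebra_simps)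
    have 2: "bailey_weight d (r - 1) * q powi ((2 + int d) * (r - 1) + 2 * int d) = - (bailey_weight d r * q powi (int d * r - r))"
      unfolding bailey_weight_def q_powi
      by (simp add: mult.assoc h_add minus_one_powi_simps) (simp add: algebra_simps power2_eq_square)
    have 3: "G (r - 1) = - (bailey_weight d r * q powi (int d * r - r)) * rqfac q (L - r)
        * ((1 - q powi (L + r + int d)) * rqfac q (L + r + int d))"
      unfolding G_def 2 1 by simp
    show "bailey_weight d r * (q powi ((2 + int d) * r + 2 * int d) * (1 - q powi (L - r))
            + q powi (int d * r - r) * (1 - q powi (L + r + int d)))
           * rqfac q (L - r) * rqfac q (L + r + int d) = G r - G (r - 1)"
      unfolding 3 unfolding G_def 1 by (simp add: distrib_left distrib_right mult_ac)
  qed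
  also have "\<dots> = G L - G (- L - int d - 1)"
    by (rule sum_telescope_int) (use assms in auto)
  also have "\<dots> = 0" by (simp add: G_def z algebra_simps)
  finally show ?thesis .
qed


text \<open>This relation evaluates the \<open>sym_arg\<close> term of \<open>bailey_sum_rec\<close>
  at \<open>f = 1\<close>. In terms of the moments \<open>B k\<close> of
  \<open>q powi (k * r)\<close> it is the telescoped identity simplified by the reflection.\<close>

lemma bailey_sum_one_aux:
  assumes "d \<le> 1" "L \<ge> 0"
  shows "bailey_sum d L (\<lambda>r. 1 + q powi (L + int d) - q powi (- r) - q powi (r + int d)) = 0"
proof -
  define B where "B k = bailey_sum d L (\<lambda>r. q powi (k * r))" for k :: int
  have lin: "bailey_sum d L (\<lambda>r. q powi (k * r + c)) = q powi c * B k" for k c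
    unfolding B_def by (subst bailey_sum_cmult[symmetric]) (simp add: power_int_add mult.commute)
  consider "d = 0" | "d = 1" using assms by linarith
  then show ?thesis
  proof cases
    case 1
    have "B k = B (1 - k)" for k
      using bailey_sum_reflect[of d L "\<lambda>r. q powi (k * r)"] 1
      by (simp add: B_def power_int_add_nz algebra_simps)
    \<comment> \<open>Reflection pairs the four moments of the telescoped identity, which becomes
      twice \<open>B (-1) - q powi L * B 0 = 0\<close>.\<close>
    from this[of 0] this[of "-1"] have r: "B 1 = B 0" "B 2 = B (-1)" by simp_all
    have "0 = bailey_sum d L (\<lambda>r. q powi (2 * r + 0) + q powi ((-1) * r + 0) - q powi (1 * r + L) - q powi (0 * r + L))"
      using bailey_sum_telescope[OF assms(2), of d] 1
      by (simp add: right_diff_distrib power_int_add_nz algebra_simps)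
    also have "\<dots> = B 2 + B (-1) - q powi L * B 1 - q powi L * B 0"
      unfolding bailey_sum_linear lin by simp
    finally have "B (-1) = q powi L * B 0" unfolding r by simp
    moreover have "bailey_sum d L (\<lambda>r. 1 + q powi (L + int d) - q powi (- r) - q powi (r + int d))
      = bailey_sum d L (\<lambda>r. q powi (0 * r + 0) + q powi (0 * r + L) - q powi ((-1) * r + 0) - q powi (1 * r + 0))"
      using 1 by simp
    ultimately show ?thesis unfolding bailey_sum_linear lin using r by simp
  next
    case 2
    have "B k = - (q powi (1 - k) * B (2 - k))" for k
      using bailey_sum_reflect[of d L "\<lambda>r. q powi (k * r)"] 2
      by (simp add: power_int_add_nz lin[symmetric]) (simp add: B_def algebra_simps)
    \<comment> \<open>The moment \<open>B 1\<close> is fixed by the reflection up to sign -1, hence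
      zero.\<close>
    from this[of 0] this[of 1] this[of "-1"]
    have r: "B 0 = - q * B 2" "B 1 = 0" "B (-1) = - (q powi 2) * B 3" by simp_all
    have "0 = bailey_sum d L (\<lambda>r. q powi (3 * r + 2) - q powi (2 * r + (L + 2)) + q powi (0 * r + 0) - q powi (1 * r + (L + 1)))"
      using bailey_sum_telescope[OF assms(2), of d] 2
      by (simp add: right_diff_distrib power_int_add_nz algebra_simps)
    also have "\<dots> = q powi 2 * B 3 - q powi (L + 2) * B 2 + B 0 - q powi (L + 1) * B 1"
      unfolding bailey_sum_linear lin by simp
    finally have "0 = - B (-1) + q powi (L + 1) * B 0 + B 0"
      unfolding r by (simp add: power_int_add power2_eq_square mult.assoc)
    moreover have "bailey_sum d L (\<lambda>r. 1 + q powi (L + int d) - q powi (- r) - q powi (r + int d))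
      = bailey_sum d L (\<lambda>r. q powi (0 * r + 0) + q powi (0 * r + (L + 1)) - q powi ((-1) * r + 0) - q powi (1 * r + 1))"
      using 2 by simp
    ultimately show ?thesis unfolding bailey_sum_linear lin by (simp add: r(2) algebra_simps)
  qed
qed

lemma bailey_sum_neg: "bailey_sum d L f = 0" if "L < 0" "d \<le> 1"
  using that by (simp add: bailey_sum_def)

text \<open>By \<open>bailey_sum_one_aux\<close> the recurrence in \<open>L\<close> collapses to
  \<open>(1 - q^L) \<beta>_L = \<beta>_(L-1)\<close>, the one satisfied by \<open>rqfac\<close>;
  both sides equal 1 at \<open>L = 0\<close>.\<close>

lemma bailey_sum_one: "bailey_sum d L (\<lambda>r. 1) = rqfac q L" if d: "d \<le> 1"
proof (cases "L < 0")
  case True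
  then show ?thesis using d by (simp add: bailey_sum_neg rqfac_def)
next
  case False
  have rec: "(1 - q powi L) * bailey_sum d L (\<lambda>r. 1) = bailey_sum d (L - 1) (\<lambda>r. 1)" if "L \<ge> 0" for L
  proof -
    have *: "q powi (2 * L + int d) = q powi L * q powi (L + int d)"
      by (simp add: power_int_add_nz)
    have "q powi L * h powi int d * bailey_sum d L (\<lambda>r. sym_arg d r * 1)
        = bailey_sum d L (\<lambda>r. q powi L * (q powi (- r) + q powi (r + int d)))"
      unfolding bailey_sum_cmult[symmetric] mult_1_right h_powi_sym_arg
      by (simp add: power_int_add_nz distrib_left algebra_simps)
    also have "\<dots> = q powi L * (bailey_sum d L (\<lambda>r. q powi (- r)) + bailey_sum d L (\<lambda>r. q powi (r + int d)))"
      unfolding bailey_sum_cmult bailey_sum_add ..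
    also have "bailey_sum d L (\<lambda>r. q powi (- r)) + bailey_sum d L (\<lambda>r. q powi (r + int d))
        = (1 + q powi (L + int d)) * bailey_sum d L (\<lambda>r. 1)"
      using bailey_sum_one_aux[OF d that] bailey_sum_cmult[of d L "1 + q powi (L + int d)" "\<lambda>r. 1"]
      unfolding bailey_sum_diff by (simp add: algebra_simps)
    finally show ?thesis unfolding bailey_sum_rec[of d L] * by (simp add: algebra_simps)
  qed
  define n where "n = nat L"
  have "bailey_sum d (int n) (\<lambda>r. 1) = rqfac q (int n)"
  proof (induction n)
    case 0
    consider "d = 0" | "d = 1" using d by linarith
    then show ?case
    proof cases
      case 1 then show ?thesis by (simp add: bailey_sum_def bailey_weight_def rqfac_def qfac_def)
    next
      case 2
      \<comment> \<open>The two terms are \<open>- q / (1 - q)\<close> at \<open>r = - 1\<close> and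
        \<open>1 / (1 - q)\<close> at \<open>r = 0\<close>.\<close>
      have "{- 1..0} = {- 1, 0 :: int}" by auto
      moreover have "1 - q \<noteq> 0" using power_neq_1[of 1] by auto
      ultimately show ?thesis using 2 h_sq
        by (simp add: bailey_sum_def bailey_weight_def rqfac_def qfac_def divide_simps)
    qed
  next
    case (Suc n)
    have nz: "1 - q powi (int (Suc n)) \<noteq> 0"
      using power_neq_1[of "Suc n"] unfolding power_int_of_nat by auto
    have "(1 - q powi (int (Suc n))) * bailey_sum d (int (Suc n)) (\<lambda>r. 1)
       = (1 - q powi (int (Suc n))) * rqfac q (int (Suc n))"
      using rec[of "int (Suc n)"] rqfac_step[of "int (Suc n)"] Suc by simp
    then show ?case using nz by (simp only: mult_cancel_left) simp
  qed
  then show ?thesis using False by (simp add: n_def)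
qed

text \<open>Continuous big q-Hermite polynomials in base \<open>1/q\<close> with parameter
  \<open>h powi (- int d)\<close>, in the variable \<open>X + 1/X\<close>. With these coefficients
  \<open>bailey_sum_rec\<close> produces a pure factor \<open>q powi (int k * L)\<close>.\<close>

definition col_poly :: "nat \<Rightarrow> nat \<Rightarrow> complex poly" where
  "col_poly d = three_term_poly (\<lambda>k. h powi (- (2 * int k + int d))) (\<lambda>k. 1 - q powi (- int k))"

text \<open>At \<open>k = 0\<close> the coefficient \<open>1 - q powi 0\<close> is zero, so the
  truncated index \<open>k - 1\<close> does no harm.\<close>

lemma col_poly_rec: "col_poly d (Suc k) = [:- (h powi (- (2 * int k + int d))), 1:] * col_poly d k
    - smult (1 - q powi (- int k)) (col_poly d (k - 1))"
  by (cases k) (simp_all add: col_poly_def)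

text \<open>Induction on \<open>k\<close>: \<open>bailey_sum_rec\<close> expresses the insertion of
  \<open>sym_arg\<close> through the values at \<open>L\<close> and \<open>L - 1\<close>. The
  polynomial recurrence cancels everything except the term with
  \<open>q powi (2 * L + int d)\<close>, which raises \<open>k\<close> by one.\<close>

lemma bailey_sum_col_poly:
  assumes d: "d \<le> 1"
  shows "bailey_sum d L (\<lambda>r. poly (col_poly d k) (sym_arg d r)) = h powi (int d * int k) * q powi (int k * L) * rqfac q L"
proof (induction k arbitrary: L rule: less_induct)
  case (less k)
  show ?case
  proof (cases k)
    case 0
    then show ?thesis using bailey_sum_one[OF d] by (simp add: col_poly_def)
  next
    case (Suc j)
    define a b where "a = h powi (- (2 * int j + int d))" and "b = 1 - q powi (- int j)"
    define B where "B i L = bailey_sum d L (\<lambda>r. poly (col_poly d i) (sym_arg d r))" for i L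
    define V where "V i L = h powi (int d * int i) * q powi (int i * L) * rqfac q L" for i L
    have IH: "B j L = V j L" for L unfolding B_def V_def by (rule less.IH) (simp add: Suc)
    \<comment> \<open>The exponent uses the integer \<open>int j - 1\<close>; for
      \<open>j = 0\<close> both sides vanish because \<open>b = 0\<close>.\<close>
    have bIH: "b * B (j - 1) L = b * (h powi (int d * (int j - 1)) * q powi ((int j - 1) * L) * rqfac q L)"
    proof (cases j)
      case 0 then show ?thesis by (simp add: b_def)
    next
      case (Suc i)
      have "B (j - 1) L = V (j - 1) L" unfolding B_def V_def by (rule less.IH) (simp add: Suc \<open>k = Suc j\<close>)
      then show ?thesis using Suc by (simp add: V_def)
    qed
    \<comment> \<open>The nonzero factor of the inserted \<open>sym_arg\<close> in
      \<open>bailey_sum_rec\<close>; multiplying by it avoids division.\<close>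
    define c where "c = q powi L * h powi int d"
    have c: "c \<noteq> 0" by (simp add: c_def)
    have "(\<lambda>r. poly (col_poly d k) (sym_arg d r)) = (\<lambda>r. sym_arg d r * poly (col_poly d j) (sym_arg d r)
        - a * poly (col_poly d j) (sym_arg d r) - b * poly (col_poly d (j - 1)) (sym_arg d r))"
      unfolding Suc col_poly_rec by (simp add: a_def b_def algebra_simps)
    then have B_k: "B k L = bailey_sum d L (\<lambda>r. sym_arg d r * poly (col_poly d j) (sym_arg d r)) - a * B j L - b * B (j - 1) L"
      unfolding B_def by (simp add: bailey_sum_linear)
    have cU: "c * bailey_sum d L (\<lambda>r. sym_arg d r * poly (col_poly d j) (sym_arg d r))
        = (1 + q powi (2 * L + int d)) * V j L - V j (L - 1)"
      using bailey_sum_rec[of d L "\<lambda>r. poly (col_poly d j) (sym_arg d r)"]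
      unfolding B_def[symmetric] c_def[symmetric] IH by (simp add: algebra_simps)
    have "c * B k L = (1 + q powi (2 * L + int d)) * V j L - V j (L - 1) - c * a * V j L
        - c * (b * B (j - 1) L)"
      unfolding B_k right_diff_distrib cU IH by (simp only: mult.assoc)
    also have "\<dots> = c * V k L"
    proof -
      define W where "W = h powi (int d * int j) * q powi (int j * L) * rqfac q L"
      have 1: "V j L = W" by (simp add: V_def W_def)
      have 2: "V j (L - 1) = q powi (- int j) * (1 - q powi L) * W"
      proof -
        have "q powi (int j * (L - 1)) = q powi (- int j) * q powi (int j * L)"
          by (simp add: power_int_add_nz algebra_simps)
        then show ?thesis by (simp add: V_def W_def rqfac_step[symmetric])
      qed
      have 3: "c * (b * B (j - 1) L) = (1 - q powi (- int j)) * W"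
      proof -
        have e: "c * h powi (int d * (int j - 1)) * q powi ((int j - 1) * L)
          = h powi (int d * int j) * q powi (int j * L)"
          unfolding c_def q_powi by (simp add: mult.assoc h_add algebra_simps del: power_int_of_nat)
        have "c * (b * (x * y * z)) = b * (c * x * y) * z" for x y z by (simp only: mult_ac)
        then show ?thesis unfolding bIH by (simp only: e) (simp add: W_def b_def mult.assoc)
      qed
      have 4: "c * a = q powi L * q powi (- int j)"
        unfolding c_def a_def q_powi by (simp add: mult.assoc h_add algebra_simps del: power_int_of_nat)
      have 5: "c * V k L = q powi (2 * L + int d) * W"
        unfolding c_def V_def W_def Suc q_powi
        by (simp add: mult.assoc h_add h_add' algebra_simps del: power_int_of_nat)
      show ?thesis unfolding 1 2 3 4 5 by (simp add: algebra_simps)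
    qed
    finally have "B k L = V k L" using c by simp
    then show ?thesis by (simp add: B_def V_def)
  qed
qed

text \<open>Induction on the polynomial with \<open>b\<close> free, since multiplying by
  \<open>X\<close> or \<open>1/X\<close> shifts \<open>b\<close> by 2 or -2.\<close>

lemma abs_summable_gauss_poly:
  assumes a: "a \<ge> 1"
  shows "(\<lambda>r. h powi (a * r\<^sup>2 + b * r) * poly p (sym_arg d r)) abs_summable_on UNIV"
proof (induction p arbitrary: b)
  case (pCons c p)
  have 1: "(\<lambda>r. norm c * norm (h powi (a * r\<^sup>2 + b * r))) summable_on UNIV"
    by (intro summable_on_cmult_right abs_summable_gauss norm_h a)
  have 2: "(\<lambda>r. norm (h powi int d) * norm (h powi (a * r\<^sup>2 + (b + 2) * r) * poly p (sym_arg d r))) summable_on UNIV"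
    by (intro summable_on_cmult_right pCons.IH)
  have 3: "(\<lambda>r. norm (h powi (- int d)) * norm (h powi (a * r\<^sup>2 + (b - 2) * r) * poly p (sym_arg d r))) summable_on UNIV"
    by (intro summable_on_cmult_right pCons.IH)
  show ?case
  proof (rule abs_summable_on_comparison_test'[OF summable_on_add[OF summable_on_add[OF 1 2] 3]])
    fix r
    have e: "h powi (a * r\<^sup>2 + b * r) * h powi (2 * r + int d) = h powi int d * h powi (a * r\<^sup>2 + (b + 2) * r)"
      "h powi (a * r\<^sup>2 + b * r) * h powi (- (2 * r + int d)) = h powi (- int d) * h powi (a * r\<^sup>2 + (b - 2) * r)"
      unfolding h_add by (simp_all add: algebra_simps del: power_int_of_nat)
    have "h powi (a * r\<^sup>2 + b * r) * poly (pCons c p) (sym_arg d r) = c * h powi (a * r\<^sup>2 + b * r)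
      + (h powi (a * r\<^sup>2 + b * r) * h powi (2 * r + int d)) * poly p (sym_arg d r)
      + (h powi (a * r\<^sup>2 + b * r) * h powi (- (2 * r + int d))) * poly p (sym_arg d r)"
      by (simp add: sym_arg_def distrib_left distrib_right mult.commute mult.left_commute del: power_int_of_nat)
    then show "norm (h powi (a * r\<^sup>2 + b * r) * poly (pCons c p) (sym_arg d r))
      \<le> norm c * norm (h powi (a * r\<^sup>2 + b * r))
        + norm (h powi int d) * norm (h powi (a * r\<^sup>2 + (b + 2) * r) * poly p (sym_arg d r))
        + norm (h powi (- int d)) * norm (h powi (a * r\<^sup>2 + (b - 2) * r) * poly p (sym_arg d r))"
      unfolding e by (simp only: norm_mult[symmetric] mult.assoc) (intro order_trans[OF norm_triangle_ineq] add_mono order_refl)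
  qed
qed simp

end

section \<open>The theta functional\<close>

context nome
begin

section \<open>Rogers-Ramanujan sums\<close>

definition rr_sum :: "int \<Rightarrow> complex" where
  "rr_sum m = (\<Sum>\<^sub>\<infinity>L. q powi (L\<^sup>2 + m * L) * rqfac q L)"

lemma rr_sum_has_sum: "((\<lambda>L. q powi (L\<^sup>2 + m * L) * rqfac q L) has_sum rr_sum m) UNIV"
  unfolding rr_sum_def by (rule has_sum_infsum[OF abs_summable_summable[OF abs_summable_gauss_rqfac]])

text \<open>Write \<open>1 = q^L + (1 - q^L)\<close> in each term; the second part lowers the index
  of the q-factorial, after which \<open>L\<close> is shifted by one.\<close>

lemma rr_sum_rec: "rr_sum m = rr_sum (m + 1) + q powi (m + 1) * rr_sum (m + 2)"
proof -
  define f where "f = (\<lambda>L. q powi (m + 1) * (q powi (L\<^sup>2 + (m + 2) * L) * rqfac q L))"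
  have "(f has_sum q powi (m + 1) * rr_sum (m + 2)) UNIV"
    unfolding f_def by (rule has_sum_cmult_right[OF rr_sum_has_sum])
  then have "((\<lambda>L. f (L - 1)) has_sum q powi (m + 1) * rr_sum (m + 2)) UNIV"
    by (subst has_sum_reindex_bij_witness[where i="\<lambda>s. s + 1" and j="\<lambda>s. s - 1" and T=UNIV and h=f]) auto
  from has_sum_add[OF rr_sum_has_sum[of "m + 1"] this]
  have "((\<lambda>L. q powi (L\<^sup>2 + (m + 1) * L) * rqfac q L + f (L - 1)) has_sum
      rr_sum (m + 1) + q powi (m + 1) * rr_sum (m + 2)) UNIV" .
  moreover have "q powi (L\<^sup>2 + (m + 1) * L) * rqfac q L + f (L - 1) = q powi (L\<^sup>2 + m * L) * rqfac q L" for L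
  proof -
    have "f (L - 1) = q powi (L\<^sup>2 + m * L) * rqfac q (L - 1)"
      unfolding f_def mult.assoc[symmetric] by (simp add: power_int_add_nz algebra_simps power2_eq_square)
    also have "\<dots> = q powi (L\<^sup>2 + m * L) * ((1 - q powi L) * rqfac q L)"
      by (simp add: rqfac_step)
    finally have 1: "f (L - 1) = q powi (L\<^sup>2 + m * L) * ((1 - q powi L) * rqfac q L)" .
    have 2: "q powi (L\<^sup>2 + (m + 1) * L) = q powi (L\<^sup>2 + m * L) * q powi L"
      by (simp add: power_int_add_nz algebra_simps)
    show ?thesis unfolding 1 2 by (simp add: algebra_simps)
  qed
  ultimately show ?thesis using rr_sum_has_sum[of m] by (simp add: has_sum_unique)
qed

end

context sqrt_nome
begin

text \<open>\<open>theta_mom d j p\<close> is the value \<open>\<Lambda> (X\<^sup>j p(X + 1/X))\<close> of the functional.\<close>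

definition theta_mom :: "nat \<Rightarrow> int \<Rightarrow> complex poly \<Rightarrow> complex" where
  "theta_mom d j p = (\<Sum>\<^sub>\<infinity>r. theta_weight d r * (h powi (j * (2 * r + int d)) * poly p (sym_arg d r))) / qpoch_inf q q"

abbreviation theta_mom0 :: "nat \<Rightarrow> complex poly \<Rightarrow> complex" where
  "theta_mom0 d \<equiv> theta_mom d 0"

section \<open>Linearity and symmetry of the functional\<close>

lemma theta_mom_summable:
  "(\<lambda>r. theta_weight d r * (h powi (j * (2 * r + int d)) * poly p (sym_arg d r))) summable_on UNIV"
proof -
  have "(\<lambda>r. h powi (5 * r\<^sup>2 + (4 * int d + 2 * j - 1) * r) * poly p (sym_arg d r)) abs_summable_on UNIV"
    by (rule abs_summable_gauss_poly) simp
  then have "(\<lambda>r. norm (h powi (j * int d)) * norm (h powi (5 * r\<^sup>2 + (4 * int d + 2 * j - 1) * r) * poly p (sym_arg d r))) summable_on UNIV"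
    by (rule summable_on_cmult_right)
  then have "(\<lambda>r. theta_weight d r * (h powi (j * (2 * r + int d)) * poly p (sym_arg d r))) abs_summable_on UNIV"
  proof (rule abs_summable_on_comparison_test')
    fix r
    have e: "h powi (5 * r\<^sup>2 - r + 4 * int d * r) * h powi (j * (2 * r + int d))
      = h powi (j * int d) * h powi (5 * r\<^sup>2 + (4 * int d + 2 * j - 1) * r)"
      unfolding h_add by (simp add: algebra_simps)
    have "theta_weight d r * (h powi (j * (2 * r + int d)) * poly p (sym_arg d r))
      = (- 1) powi r * (h powi (5 * r\<^sup>2 - r + 4 * int d * r) * h powi (j * (2 * r + int d))) * poly p (sym_arg d r)"
      by (simp add: theta_weight_def)
    then have E: "theta_weight d r * (h powi (j * (2 * r + int d)) * poly p (sym_arg d r))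
      = (- 1) powi r * (h powi (j * int d) * (h powi (5 * r\<^sup>2 + (4 * int d + 2 * j - 1) * r) * poly p (sym_arg d r)))"
      unfolding e by (simp only: mult.assoc)
    show "norm (theta_weight d r * (h powi (j * (2 * r + int d)) * poly p (sym_arg d r)))
      \<le> norm (h powi (j * int d)) * norm (h powi (5 * r\<^sup>2 + (4 * int d + 2 * j - 1) * r) * poly p (sym_arg d r))"
      unfolding E by (simp add: norm_mult norm_power_int)
  qed
  then show ?thesis by (rule abs_summable_summable)
qed

lemma theta_mom_has_sum:
  "((\<lambda>r. theta_weight d r * (h powi (j * (2 * r + int d)) * poly p (sym_arg d r))) has_sum theta_mom d j p * qpoch_inf q q) UNIV"
  using has_sum_infsum[OF theta_mom_summable[of d j p]] qpoch_q_neq_0 by (simp add: theta_mom_def)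

lemma theta_mom_eqI:
  assumes "((\<lambda>r. theta_weight d r * (h powi (j * (2 * r + int d)) * poly p (sym_arg d r))) has_sum c * qpoch_inf q q) UNIV"
  shows "theta_mom d j p = c"
proof -
  have "theta_mom d j p * qpoch_inf q q = c * qpoch_inf q q" by (rule has_sum_unique[OF theta_mom_has_sum assms])
  then show ?thesis using qpoch_q_neq_0 by simp
qed

lemma theta_mom_add: "theta_mom d j (p + r) = theta_mom d j p + theta_mom d j r"
  using has_sum_add[OF theta_mom_has_sum[of d j p] theta_mom_has_sum[of d j r]]
  by (intro theta_mom_eqI) (simp add: algebra_simps)

lemma theta_mom_smult: "theta_mom d j (smult c p) = c * theta_mom d j p"
  using has_sum_cmult_right[OF theta_mom_has_sum[of d j p], of c]
  by (intro theta_mom_eqI) (simp add: algebra_simps)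

lemma theta_mom_diff: "theta_mom d j (p - r) = theta_mom d j p - theta_mom d j r"
  using theta_mom_add[of d j p "smult (-1) r"] unfolding theta_mom_smult by simp

lemma theta_mom_0: "theta_mom d j 0 = 0" using theta_mom_smult[of d j 0 0] by simp

lemma theta_mom_X: "theta_mom d j ([:0, 1:] * p) = theta_mom d (j + 1) p + theta_mom d (j - 1) p"
proof (rule theta_mom_eqI)
  have "theta_weight d r * (h powi (j * (2 * r + int d)) * poly ([:0, 1:] * p) (sym_arg d r))
    = theta_weight d r * (h powi ((j + 1) * (2 * r + int d)) * poly p (sym_arg d r))
      + theta_weight d r * (h powi ((j - 1) * (2 * r + int d)) * poly p (sym_arg d r))" for r
  proof -
    have "h powi (j * (2 * r + int d)) * sym_arg d r = h powi ((j + 1) * (2 * r + int d)) + h powi ((j - 1) * (2 * r + int d))"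
      unfolding sym_arg_def distrib_left h_add by (simp add: algebra_simps)
    then show ?thesis by (simp add: distrib_left[symmetric] distrib_right[symmetric] mult.assoc[symmetric])
  qed
  then show "((\<lambda>r. theta_weight d r * (h powi (j * (2 * r + int d)) * poly ([:0, 1:] * p) (sym_arg d r))) has_sum
     (theta_mom d (j + 1) p + theta_mom d (j - 1) p) * qpoch_inf q q) UNIV"
    unfolding distrib_right[of "theta_mom d (j + 1) p"] by (simp only:) (intro has_sum_add theta_mom_has_sum)
qed

text \<open>The substitution \<open>r \<mapsto> - d - r\<close> inverts \<open>X_r\<close>, fixes
  \<open>sym_arg d r\<close> and multiplies the weight by \<open>(-1)^d X_r^(1+d)\<close>.\<close>

lemma theta_mom_reflect:
  assumes "d \<le> 1"
  shows "theta_mom d j p = (- 1) ^ d * theta_mom d (1 + int d - j) p"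
proof (rule theta_mom_eqI)
  define f where "f = (\<lambda>r. (- 1) ^ d * (theta_weight d r * (h powi ((1 + int d - j) * (2 * r + int d)) * poly p (sym_arg d r))))"
  have d: "d = 0 \<or> d = 1" using assms by auto
  have "(f has_sum (- 1) ^ d * (theta_mom d (1 + int d - j) p * qpoch_inf q q)) UNIV"
    unfolding f_def by (intro has_sum_cmult_right theta_mom_has_sum)
  then have "((\<lambda>r. f (- int d - r)) has_sum (- 1) ^ d * (theta_mom d (1 + int d - j) p * qpoch_inf q q)) UNIV"
    by (subst has_sum_reindex_bij_witness[where i="\<lambda>r. - int d - r" and j="\<lambda>r. - int d - r" and T=UNIV and h=f]) auto
  moreover have "f (- int d - r) = theta_weight d r * (h powi (j * (2 * r + int d)) * poly p (sym_arg d r))" for r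
  proof -
    have 1: "sym_arg d (- int d - r) = sym_arg d r" by (simp add: sym_arg_def algebra_simps)
    have 2: "(- 1) ^ d * (theta_weight d (- int d - r) * h powi ((1 + int d - j) * (2 * (- int d - r) + int d)))
      = theta_weight d r * h powi (j * (2 * r + int d))"
      using d unfolding theta_weight_def
      by (auto simp: mult.assoc h_add minus_one_powi_simps) (simp_all add: algebra_simps power2_eq_square)
    have "f (- int d - r) = ((- 1) ^ d * (theta_weight d (- int d - r) * h powi ((1 + int d - j) * (2 * (- int d - r) + int d))))
        * poly p (sym_arg d (- int d - r))" by (simp add: f_def)
    then show ?thesis unfolding 1 2 by simp
  qed
  ultimately show "((\<lambda>r. theta_weight d r * (h powi (j * (2 * r + int d)) * poly p (sym_arg d r))) has_sum
     (- 1) ^ d * theta_mom d (1 + int d - j) p * qpoch_inf q q) UNIV" by (simp add: mult.assoc)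
qed

text \<open>The Bailey-type argument: one absolutely convergent double sum over \<open>L\<close> and
  \<open>r\<close> is evaluated in both orders.\<close>

lemma theta_mom0_col_poly:
  assumes d: "d \<le> 1"
  shows "theta_mom0 d (col_poly d k) = h powi (int d * int k) * rr_sum (int d + int k)"
proof (rule theta_mom_eqI)
  define P where "P r = poly (col_poly d k) (sym_arg d r)" for r
  define f where "f = (\<lambda>L r. q powi (L\<^sup>2 + int d * L) * bailey_weight d r * P r * rqfac q (L - r) * rqfac q (L + r + int d))"
  have bailey_weight_abs: "(\<lambda>r. bailey_weight d r * P r) abs_summable_on UNIV"
    using abs_summable_gauss_poly[of 3 "2 * int d - 1" "col_poly d k" d]
    by (rule abs_summable_on_comparison_test')
      (simp_all add: bailey_weight_def P_def norm_mult norm_power_int algebra_simps)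
  have g_abs: "(\<lambda>L. q powi (1 * L\<^sup>2 + int d * L)) abs_summable_on UNIV"
    by (rule abs_summable_gauss[OF q_nz q_lt_1]) simp
  obtain C where C: "C > 0" "\<And>s. norm (rqfac q s) \<le> C" using rqfac_bounded by blast
  have "(\<lambda>(L, r). f L r) abs_summable_on UNIV \<times> UNIV"
  proof (rule abs_summable_on_comparison_test')
    show "(\<lambda>x. norm (case x of (L, r) \<Rightarrow> q powi (1 * L\<^sup>2 + int d * L) * (bailey_weight d r * P r)) * (C * C))
        summable_on UNIV \<times> UNIV"
      by (intro summable_on_cmult_left abs_summable_prod g_abs bailey_weight_abs)
    fix x :: "int \<times> int"
    obtain L r where x: "x = (L, r)" by (cases x)
    have "norm (rqfac q (L - r)) * norm (rqfac q (L + r + int d)) \<le> C * C"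
      by (intro mult_mono C) (use C in auto)
    then have "norm (q powi (L\<^sup>2 + int d * L) * bailey_weight d r * P r) * (norm (rqfac q (L - r)) * norm (rqfac q (L + r + int d)))
      \<le> norm (q powi (L\<^sup>2 + int d * L) * bailey_weight d r * P r) * (C * C)"
      by (rule mult_left_mono) simp
    then show "norm (case x of (L, r) \<Rightarrow> f L r) \<le>
       norm (case x of (L, r) \<Rightarrow> q powi (1 * L\<^sup>2 + int d * L) * (bailey_weight d r * P r)) * (C * C)"
      by (simp add: x f_def norm_mult mult.assoc)
  qed
  then obtain S where S: "((\<lambda>(L, r). f L r) has_sum S) (UNIV \<times> UNIV)"
    using abs_summable_summable has_sum_infsum by blast
  \<comment> \<open>Summing over \<open>r\<close> first gives finite Bailey sums, known from
    \<open>bailey_sum_col_poly\<close>.\<close>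
  have "((\<lambda>L. q powi (L\<^sup>2 + int d * L) * bailey_sum d L P) has_sum S) UNIV"
  proof (rule has_sum_SigmaD[OF S])
    show "((\<lambda>r. case (L, r) of (L, r) \<Rightarrow> f L r) has_sum q powi (L\<^sup>2 + int d * L) * bailey_sum d L P) UNIV" for L
      unfolding bailey_sum_def
      by (rule has_sum_finite_neutralI[of "{- L - int d..L}"])
         (auto simp: f_def rqfac_def sum_distrib_left mult_ac)
  qed
  moreover have "q powi (L\<^sup>2 + int d * L) * bailey_sum d L P
      = h powi (int d * int k) * (q powi (L\<^sup>2 + (int d + int k) * L) * rqfac q L)" for L
  proof -
    have "q powi (L\<^sup>2 + (int d + int k) * L) = q powi (L\<^sup>2 + int d * L) * q powi (int k * L)"
      by (simp add: power_int_add_nz algebra_simps)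
    then show ?thesis unfolding P_def bailey_sum_col_poly[OF d] by simp
  qed
  ultimately have "((\<lambda>L. h powi (int d * int k) * (q powi (L\<^sup>2 + (int d + int k) * L) * rqfac q L)) has_sum S) UNIV"
    by simp
  then have S_eq: "S = h powi (int d * int k) * rr_sum (int d + int k)"
    by (rule has_sum_unique) (intro has_sum_cmult_right rr_sum_has_sum)
  \<comment> \<open>Summing over \<open>L\<close> first, shifted by \<open>r\<close>, gives
    \<open>durfee (2 * r + int d)\<close>, and the theta weight emerges.\<close>
  have "((\<lambda>(r, L). f L r) has_sum S) (UNIV \<times> UNIV)"
    using S by (subst has_sum_swap) simp
  then have "((\<lambda>r. theta_weight d r * P r * (1 / qpoch_inf q q)) has_sum S) UNIV"
  proof (rule has_sum_SigmaD)
    fix r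
    have "((\<lambda>s. theta_weight d r * P r * (q powi (s\<^sup>2 + (2 * r + int d) * s) * rqfac q s * rqfac q (s + (2 * r + int d))))
       has_sum theta_weight d r * P r * durfee (2 * r + int d)) UNIV"
      by (intro has_sum_cmult_right durfee_has_sum)
    then have "((\<lambda>L. theta_weight d r * P r * (q powi ((L - r)\<^sup>2 + (2 * r + int d) * (L - r)) * rqfac q (L - r) * rqfac q (L - r + (2 * r + int d))))
       has_sum theta_weight d r * P r * durfee (2 * r + int d)) UNIV"
      by (subst has_sum_reindex_bij_witness[where i="\<lambda>s. s + r" and j="\<lambda>s. s - r" and T=UNIV
            and h="\<lambda>s. theta_weight d r * P r * (q powi (s\<^sup>2 + (2 * r + int d) * s) * rqfac q s * rqfac q (s + (2 * r + int d)))"]) auto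
    moreover have "theta_weight d r * P r * (q powi ((L - r)\<^sup>2 + (2 * r + int d) * (L - r)) * rqfac q (L - r) * rqfac q (L - r + (2 * r + int d)))
       = f L r" for L
    proof -
      have e: "q powi (r\<^sup>2 + int d * r) * q powi ((L - r)\<^sup>2 + (2 * r + int d) * (L - r)) = q powi (L\<^sup>2 + int d * L)"
        by (simp add: power_int_add_nz algebra_simps power2_eq_square)
      have "L - r + (2 * r + int d) = L + r + int d" by simp
      then show ?thesis unfolding theta_weight_eq_bailey_weight f_def e[symmetric] by (simp only: mult_ac)
    qed
    ultimately show "((\<lambda>L. case (r, L) of (r, L) \<Rightarrow> f L r) has_sum theta_weight d r * P r * (1 / qpoch_inf q q)) UNIV"
      by (simp add: durfee_eq)
  qed
  from has_sum_cmult_left[OF this, of "qpoch_inf q q"]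
  show "((\<lambda>r. theta_weight d r * (h powi (0 * (2 * r + int d)) * poly (col_poly d k) (sym_arg d r))) has_sum
     h powi (int d * int k) * rr_sum (int d + int k) * qpoch_inf q q) UNIV"
    using qpoch_q_neq_0 unfolding P_def S_eq by simp
qed

text \<open>\<open>row_poly N\<close> is, up to a factor, the polynomial in \<open>X\<^sub>r + 1/X\<^sub>r\<close> that arises from
  \<open>\<Sum>\<^sub>L q\<^bsup>L\<^sup>2+dL-NL\<^esup> / ((q)\<^bsub>L-r\<^esub> (q)\<^bsub>L+r+d\<^esub>)\<close>.\<close>

definition row_poly :: "nat \<Rightarrow> complex poly" where
  "row_poly = three_term_poly (\<lambda>_. 0) (\<lambda>k. 1 - q powi (- int k))"

lemma row_poly_rec: "row_poly (Suc k) = [:0, 1:] * row_poly k - smult (1 - q powi (- int k)) (row_poly (k - 1))"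
  by (cases k) (simp_all add: row_poly_def)

text \<open>Induction on \<open>N\<close> for all \<open>k\<close> at once: the recurrence of
  \<open>row_poly\<close> frees a factor \<open>X + 1/X\<close>, the recurrence of
  \<open>col_poly\<close> absorbs it, and the resulting combination of three sums is
  \<open>rr_sum_rec\<close>.\<close>

lemma theta_mom0_row_col:
  assumes d: "d \<le> 1"
  shows "theta_mom0 d (row_poly N * col_poly d k) = h powi (int d * (int k - int N)) * rr_sum (int d + int k - int N)"
proof (induction N arbitrary: k rule: less_induct)
  case (less N)
  show ?case
  proof (cases N)
    case 0
    then show ?thesis using theta_mom0_col_poly[OF d, of k] by (simp add: row_poly_def)
  next
    case (Suc M)
    define m where "m = int d + int k - int N"
    define Z where "Z = h powi (int d * (int k - int N))"
    define a b c where "a = h powi (- (2 * int k + int d))" and "b = 1 - q powi (- int k)"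
      and "c = 1 - q powi (- int M)"
    have X: "[:0, 1:] * col_poly d k = col_poly d (Suc k) + smult a (col_poly d k) + smult b (col_poly d (k - 1))"
      unfolding col_poly_rec a_def b_def by (simp add: algebra_simps)
    have "row_poly N * col_poly d k = row_poly M * ([:0, 1:] * col_poly d k) - smult c (row_poly (M - 1) * col_poly d k)"
      unfolding Suc row_poly_rec c_def by (simp add: algebra_simps)
    then have eq: "theta_mom0 d (row_poly N * col_poly d k) = theta_mom0 d (row_poly M * col_poly d (Suc k)) + a * theta_mom0 d (row_poly M * col_poly d k)
        + b * theta_mom0 d (row_poly M * col_poly d (k - 1)) - c * theta_mom0 d (row_poly (M - 1) * col_poly d k)"
      unfolding X by (simp add: distrib_left theta_mom_add theta_mom_diff theta_mom_smult)
    have 1: "theta_mom0 d (row_poly M * col_poly d (Suc k)) = Z * q powi (int d) * rr_sum (m + 2)"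
      by (subst less.IH) (simp_all add: Suc m_def Z_def q_powi h_add algebra_simps del: power_int_of_nat)
    have 2: "a * theta_mom0 d (row_poly M * col_poly d k) = Z * q powi (- int k) * rr_sum (m + 1)"
    proof -
      have "a * h powi (int d * (int k - int M)) = Z * q powi (- int k)"
        unfolding a_def Z_def q_powi h_add by (simp add: Suc algebra_simps)
      moreover have "theta_mom0 d (row_poly M * col_poly d k) = h powi (int d * (int k - int M)) * rr_sum (m + 1)"
        by (subst less.IH) (simp_all add: Suc m_def algebra_simps)
      ultimately show ?thesis by (simp flip: mult.assoc)
    qed
    \<comment> \<open>At \<open>k = 0\<close> the coefficient \<open>b\<close> vanishes and covers
      the truncated index; the same happens below with \<open>c\<close> at
      \<open>M = 0\<close>.\<close>
    have 3: "b * theta_mom0 d (row_poly M * col_poly d (k - 1)) = b * (Z * rr_sum m)"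
    proof (cases k)
      case 0 then show ?thesis by (simp add: b_def)
    next
      case (Suc j)
      then show ?thesis by (subst less.IH) (simp_all add: \<open>N = Suc M\<close> m_def Z_def algebra_simps)
    qed
    have 4: "c * theta_mom0 d (row_poly (M - 1) * col_poly d k) = c * (Z * q powi (int d) * rr_sum (m + 2))"
    proof (cases M)
      case 0 then show ?thesis by (simp add: c_def)
    next
      case (Suc j)
      then show ?thesis
        by (subst less.IH) (simp_all add: \<open>N = Suc M\<close> m_def Z_def q_powi h_add algebra_simps del: power_int_of_nat)
    qed
    \<comment> \<open>This is \<open>rr_sum_rec\<close> scaled by \<open>q powi (- int k)\<close>,
      the coefficient with which the middle sum occurs.\<close>
    have 5: "q powi (- int k) * rr_sum m = q powi (- int k) * rr_sum (m + 1) + q powi (int d) * q powi (- int M) * rr_sum (m + 2)"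
    proof -
      have "q powi (- int k) * q powi (m + 1) = q powi (int d) * q powi (- int M)"
        by (simp add: power_int_add_nz m_def Suc del: power_int_of_nat)
      then show ?thesis by (subst rr_sum_rec[of m]) (simp add: distrib_left flip: mult.assoc)
    qed
    have "theta_mom0 d (row_poly N * col_poly d k) = Z * (q powi (- int k) * rr_sum (m + 1)
         + q powi (int d) * q powi (- int M) * rr_sum (m + 2) + b * rr_sum m)"
      unfolding eq 1 2 3 4 unfolding c_def by (simp add: algebra_simps)
    also have "\<dots> = Z * rr_sum m" unfolding 5[symmetric] b_def by (simp add: algebra_simps)
    finally show ?thesis by (simp add: Z_def m_def)
  qed
qed

end

section \<open>Theta functions and monic families\<close>

context sqrt_nome
begin

text \<open>The quotient of infinite products in front of the determinant is moved into the entries,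
  so that the triple product in base \<open>q ^ 5\<close> gives an entry as a series divided by
  \<open>qpoch_inf q q\<close>.\<close>

definition norm_theta :: "int \<Rightarrow> complex" where
  "norm_theta m = qpoch_inf (q ^ 5) (q ^ 5) / qpoch_inf q q * qtheta (q powi m) (q ^ 5)"

lemma norm_theta_has_sum:
  "((\<lambda>r. (- 1) powi r * h powi (5 * (r * (r - 1)) + 2 * m * r)) has_sum norm_theta m * qpoch_inf q q) UNIV"
proof -
  interpret q5: nome "q ^ 5"
    by unfold_locales (use q_nz q_lt_1 in \<open>auto simp: norm_power power_less_one_iff\<close>)
  have "(q ^ 5) powi (r * (r - 1) div 2) * (q powi m) powi r = h powi (5 * (r * (r - 1)) + 2 * m * r)" for r
  proof -
    have "(q ^ 5) powi (r * (r - 1) div 2) = q powi (5 * (r * (r - 1) div 2))"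
      by (simp add: power_int_power)
    also have "\<dots> = h powi (5 * (2 * (r * (r - 1) div 2)))"
      unfolding q_powi by (simp only: mult.left_commute)
    also have "2 * (r * (r - 1) div 2) = r * (r - 1)" by simp
    finally have "(q ^ 5) powi (r * (r - 1) div 2) = h powi (5 * (r * (r - 1)))" .
    moreover have "(q powi m) powi r = h powi (2 * m * r)"
      unfolding power_int_mult[symmetric] q_powi by (simp only: mult.assoc)
    ultimately show ?thesis by (simp only: h_add)
  qed
  then have "((\<lambda>r. (- 1) powi r * h powi (5 * (r * (r - 1)) + 2 * m * r)) has_sum
      qpoch_inf (q ^ 5) (q ^ 5) * qtheta (q powi m) (q ^ 5)) UNIV"
    using q5.jacobi_triple_product[of "q powi m"] by (simp add: mult.assoc)
  then show ?thesis using qpoch_q_neq_0 by (simp add: norm_theta_def)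
qed

text \<open>Quasi-periodicity of theta, from shifting the summation index by
  \<open>N\<close>.\<close>

lemma norm_theta_shift: "h powi (2 * m * N + 5 * (N * (N - 1))) * norm_theta (m + 5 * N) = (- 1) powi N * norm_theta m"
proof -
  define f where "f = (\<lambda>r. h powi (2 * m * N + 5 * (N * (N - 1))) *
      ((- 1) powi r * h powi (5 * (r * (r - 1)) + 2 * (m + 5 * N) * r)))"
  have "(f has_sum h powi (2 * m * N + 5 * (N * (N - 1))) * (norm_theta (m + 5 * N) * qpoch_inf q q)) UNIV"
    unfolding f_def by (intro has_sum_cmult_right norm_theta_has_sum)
  then have 1: "((\<lambda>r. f (r - N)) has_sum h powi (2 * m * N + 5 * (N * (N - 1))) * (norm_theta (m + 5 * N) * qpoch_inf q q)) UNIV"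
    by (subst has_sum_reindex_bij_witness[where i="\<lambda>s. s + N" and j="\<lambda>s. s - N" and T=UNIV and h=f]) auto
  have "f (r - N) = (- 1) powi N * ((- 1) powi r * h powi (5 * (r * (r - 1)) + 2 * m * r))" for r
  proof -
    have "(- 1) powi (r - N) = (- 1) powi N * ((- 1) powi r :: complex)"
      using power_int_add[of "- 1 :: complex" r "- N"] by (simp add: minus_one_powi_simps mult.commute)
    moreover have "h powi (2 * m * N + 5 * (N * (N - 1))) * h powi (5 * ((r - N) * (r - N - 1)) + 2 * (m + 5 * N) * (r - N))
        = h powi (5 * (r * (r - 1)) + 2 * m * r)"
      unfolding h_add by (simp add: algebra_simps)
    ultimately show ?thesis unfolding f_def by (simp add: mult_ac)
  qed
  with 1 have "((\<lambda>r. (- 1) powi N * ((- 1) powi r * h powi (5 * (r * (r - 1)) + 2 * m * r))) has_sum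
     h powi (2 * m * N + 5 * (N * (N - 1))) * (norm_theta (m + 5 * N) * qpoch_inf q q)) UNIV" by simp
  moreover have "((\<lambda>r. (- 1) powi N * ((- 1) powi r * h powi (5 * (r * (r - 1)) + 2 * m * r))) has_sum
     (- 1) powi N * (norm_theta m * qpoch_inf q q)) UNIV"
    by (intro has_sum_cmult_right norm_theta_has_sum)
  ultimately have "h powi (2 * m * N + 5 * (N * (N - 1))) * (norm_theta (m + 5 * N) * qpoch_inf q q)
     = (- 1) powi N * (norm_theta m * qpoch_inf q q)" by (rule has_sum_unique)
  then show ?thesis using qpoch_q_neq_0 by simp
qed

lemma norm_theta_shift': "norm_theta (m + 5 * N) = (- 1) powi N * h powi (- (2 * m * N + 5 * (N * (N - 1)))) * norm_theta m"
proof -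
  have "h powi (- (2 * m * N + 5 * (N * (N - 1)))) * (h powi (2 * m * N + 5 * (N * (N - 1))) * norm_theta (m + 5 * N)) = norm_theta (m + 5 * N)"
    unfolding h_add' by simp
  then show ?thesis unfolding norm_theta_shift by (simp add: mult_ac)
qed

text \<open>The exponents match because \<open>5 r\<^sup>2 - r + 4 d r + 2 j r = 5 r (r - 1) + 2 (2
  + 2 d + j) r\<close>.\<close>

lemma theta_mom_one: "theta_mom d j 1 = h powi (int d * j) * norm_theta (2 + 2 * int d + j)"
proof (rule theta_mom_eqI)
  have "theta_weight d r * (h powi (j * (2 * r + int d)) * poly 1 (sym_arg d r))
     = h powi (int d * j) * ((- 1) powi r * h powi (5 * (r * (r - 1)) + 2 * (2 + 2 * int d + j) * r))" for r
  proof -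
    have "h powi (5 * r\<^sup>2 - r + 4 * int d * r) * h powi (j * (2 * r + int d))
      = h powi (int d * j) * h powi (5 * (r * (r - 1)) + 2 * (2 + 2 * int d + j) * r)"
      unfolding h_add by (simp add: algebra_simps power2_eq_square)
    then show ?thesis unfolding theta_weight_def by (simp add: mult.assoc mult.left_commute)
  qed
  then show "((\<lambda>r. theta_weight d r * (h powi (j * (2 * r + int d)) * poly 1 (sym_arg d r))) has_sum
     h powi (int d * j) * norm_theta (2 + 2 * int d + j) * qpoch_inf q q) UNIV"
    unfolding mult.assoc[of _ "norm_theta _"] by (simp only:) (intro has_sum_cmult_right norm_theta_has_sum)
qed

text \<open>Quasi-periodicity removes \<open>5 N\<close> from the theta argument and leaves the
  moment of \<open>X^(j-N)\<close>. The prefactor depends on \<open>N\<close> but not on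
  \<open>j\<close>, so it can be pulled out of a row.\<close>

lemma theta_entry_D:
  "h powi (N * (2 * N + int d)) * (h powi (j * (2 * N + int d)) * norm_theta (4 * N + 2 * int d + 2 + j))
    = (- 1) powi N * h powi (- (N * N) + N - 2 * int d * N) * theta_mom d (j - N) 1"
proof -
  define m where "m = 2 + 2 * int d + j - N"
  have m: "4 * N + 2 * int d + 2 + j = m + 5 * N" "2 + 2 * int d + (j - N) = m" by (simp_all add: m_def)
  have "h powi (N * (2 * N + int d)) * h powi (j * (2 * N + int d)) * h powi (- (2 * m * N + 5 * (N * (N - 1))))
    = h powi (- (N * N) + N - 2 * int d * N) * h powi (int d * (j - N))"
    unfolding h_add by (simp add: m_def algebra_simps)
  then show ?thesis unfolding theta_mom_one m norm_theta_shift' by (simp only: mult_ac)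
qed

text \<open>The same reduction for \<open>d = 0\<close>, with the argument lowered by
  \<open>5 (N + 1)\<close>.\<close>

lemma theta_entry_B:
  "h powi ((2 * N + 1) * (N + 1)) * (h powi ((2 * j + 1) * (N + 1)) * norm_theta (4 * N + 7 + j))
    = (- 1) powi (N + 1) * h powi (- (N * N) - 3 * N - 2) * theta_mom 0 (j - N) 1"
proof -
  define m where "m = 2 + j - N"
  have m: "4 * N + 7 + j = m + 5 * (N + 1)" "2 + 2 * int 0 + (j - N) = m" by (simp_all add: m_def)
  have "h powi ((2 * N + 1) * (N + 1)) * h powi ((2 * j + 1) * (N + 1)) * h powi (- (2 * m * (N + 1) + 5 * ((N + 1) * (N + 1 - 1))))
    = h powi (- (N * N) - 3 * N - 2)"
    unfolding h_add by (simp add: m_def algebra_simps)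
  then show ?thesis unfolding theta_mom_one m norm_theta_shift' by (simp add: mult_ac)
qed

text \<open>Modulo the reflection symmetry of \<open>\<Lambda>\<close>, \<open>reflect_poly d N\<close> represents \<open>X\<^bsup>-N\<^esup>\<close>. The symmetric
  Laurent polynomials \<open>X\<^sup>k + X\<^bsup>-k\<^esup>\<close> and \<open>X\<^sup>k + X\<^bsup>k-1\<^esup> + \<dots> + X\<^bsup>-k\<^esup>\<close> are \<open>sym_poly k\<close> (for
  \<open>k > 0\<close>) and \<open>sym_poly_B k\<close>, and \<open>reflect_poly_B\<close>, \<open>col_poly_B\<close> are the quotients by \<open>2 - u\<close>
  of consecutive differences.\<close>

definition reflect_poly :: "nat \<Rightarrow> nat \<Rightarrow> complex poly" where
  "reflect_poly d = three_term_poly (\<lambda>k. if k = 0 \<and> d = 0 then 1 else 0) (\<lambda>_. 1)"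

definition reflect_poly_B :: "nat \<Rightarrow> complex poly" where
  "reflect_poly_B = three_term_poly (\<lambda>_. 0) (\<lambda>_. 1)"

definition sym_poly :: "nat \<Rightarrow> complex poly" where
  "sym_poly = three_term_poly (\<lambda>_. 0) (\<lambda>k. if k = 1 then 2 else 1)"

definition sym_poly_B :: "nat \<Rightarrow> complex poly" where
  "sym_poly_B = three_term_poly (\<lambda>k. if k = 0 then - 1 else 0) (\<lambda>_. 1)"

text \<open>The recurrence comes from \<open>X^(-N-2) = (X + 1/X) X^(-N-1) - X^(-N)\<close>. To
  start, \<open>1/X = (X + 1/X) - X\<close>, where by reflection \<open>X\<close> acts as 1 if
  \<open>d = 0\<close> and as 0 if \<open>d = 1\<close>.\<close>

lemma theta_mom_reflect_poly:
  assumes d: "d \<le> 1"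
  shows "theta_mom d (- int N) p = theta_mom0 d (reflect_poly d N * p)"
proof (induction N arbitrary: p rule: less_induct)
  case (less N)
  consider "N = 0" | "N = 1" | M where "N = Suc (Suc M)" by (metis One_nat_def not0_implies_Suc)
  then show ?case
  proof cases
    case 1 then show ?thesis by (simp add: reflect_poly_def)
  next
    case 2
    have *: "theta_mom d (- 1) p = theta_mom0 d ([:0, 1:] * p) - theta_mom d 1 p"
      using theta_mom_X[of d 0 p] by simp
    have r: "theta_mom d 1 p = (if d = 0 then theta_mom0 d p else 0)"
    proof (cases "d = 0")
      case True then show ?thesis using theta_mom_reflect[OF d, of 1 p] by simp
    next
      case False
      then have "d = 1" using d by simp
      then show ?thesis using theta_mom_reflect[OF d, of 1 p] by simp
    qed
    have "reflect_poly d (Suc 0) * p = [:0, 1:] * p - smult (if d = 0 then 1 else 0) p"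
      by (simp add: reflect_poly_def)
    then show ?thesis using 2 * r by (simp add: theta_mom_diff theta_mom_0)
  next
    case 3
    have "theta_mom d (- int N) p = theta_mom d (- int (Suc M)) ([:0, 1:] * p) - theta_mom d (- int M) p"
      using theta_mom_X[of d "- int (Suc M)" p] by (simp add: 3)
    also have "\<dots> = theta_mom0 d (reflect_poly d (Suc M) * ([:0, 1:] * p)) - theta_mom0 d (reflect_poly d M * p)"
      using less.IH[of "Suc M"] less.IH[of M] by (simp add: 3)
    also have "\<dots> = theta_mom0 d (reflect_poly d N * p)"
      unfolding theta_mom_diff[symmetric] 3 by (rule arg_cong[of _ _ "theta_mom0 d"]) (simp add: reflect_poly_def algebra_simps)
    finally show ?thesis .
  qed
qed

text \<open>The Chebyshev recurrence for \<open>X^k + X^(-k)\<close>. At \<open>k = 0\<close> this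
  expression is 2 while the monic \<open>sym_poly 0\<close> is 1, whence the case distinction here
  and the coefficient 2 in \<open>sym_poly\<close>.\<close>

lemma theta_mom_sym_poly:
  "theta_mom d (j + int k) 1 + theta_mom d (j - int k) 1 = (if k = 0 then 2 else 1) * theta_mom d j (sym_poly k)"
proof (induction k arbitrary: j rule: less_induct)
  case (less k)
  consider "k = 0" | "k = 1" | "k = 2" | i where "k = Suc (Suc i)" "i > 0"
    by (metis One_nat_def not0_implies_Suc numeral_2_eq_2 neq0_conv)
  then show ?case
  proof cases
    case 1 then show ?thesis by (simp add: sym_poly_def)
  next
    case 2
    then show ?thesis using theta_mom_X[of d j 1] by (simp add: sym_poly_def)
  next
    case 3
    have "sym_poly 2 = [:0, 1:] * sym_poly 1 - smult 2 1" by (simp add: sym_poly_def numeral_2_eq_2)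
    then have "theta_mom d j (sym_poly 2) = theta_mom d (j + 1) (sym_poly 1) + theta_mom d (j - 1) (sym_poly 1) - 2 * theta_mom d j 1"
      by (simp only: theta_mom_diff theta_mom_smult theta_mom_X)
    moreover have "theta_mom d (j + 1) (sym_poly 1) = theta_mom d (j + 2) 1 + theta_mom d j 1"
      using less.IH[of 1 "j + 1"] 3 by (simp add: add.assoc)
    moreover have "theta_mom d (j - 1) (sym_poly 1) = theta_mom d j 1 + theta_mom d (j - 2) 1"
      using less.IH[of 1 "j - 1"] 3 by simp
    ultimately show ?thesis using 3 by simp
  next
    case (4 i)
    have "sym_poly k = [:0, 1:] * sym_poly (Suc i) - sym_poly i" using 4 by (simp add: sym_poly_def)
    then have "theta_mom d j (sym_poly k) = theta_mom d (j + 1) (sym_poly (Suc i)) + theta_mom d (j - 1) (sym_poly (Suc i)) - theta_mom d j (sym_poly i)"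
      by (simp only: theta_mom_diff theta_mom_X)
    moreover have "theta_mom d (j + 1) (sym_poly (Suc i)) = theta_mom d (j + int k) 1 + theta_mom d (j - int i) 1"
      using less.IH[of "Suc i" "j + 1"] 4 by (simp add: algebra_simps)
    moreover have "theta_mom d (j - 1) (sym_poly (Suc i)) = theta_mom d (j + int i) 1 + theta_mom d (j - int k) 1"
      using less.IH[of "Suc i" "j - 1"] 4 by (simp add: algebra_simps)
    moreover have "theta_mom d j (sym_poly i) = theta_mom d (j + int i) 1 + theta_mom d (j - int i) 1"
      using less.IH[of i j] 4 by simp
    ultimately show ?thesis using 4 by simp
  qed
qed

text \<open>Reflects \<open>X^k - X^(-k-1) = (1 - 1/X) (X^k + ... + X^(-k))\<close>.\<close>

lemma theta_mom_sym_poly_B: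
  "theta_mom d (j + int k) 1 - theta_mom d (j - int k - 1) 1 = theta_mom d j (sym_poly_B k) - theta_mom d (j - 1) (sym_poly_B k)"
proof (induction k arbitrary: j rule: less_induct)
  case (less k)
  consider "k = 0" | "k = 1" | i where "k = Suc (Suc i)" by (metis One_nat_def not0_implies_Suc)
  then show ?case
  proof cases
    case 1 then show ?thesis by (simp add: sym_poly_B_def)
  next
    case 2
    have "sym_poly_B 1 = [:0, 1:] * 1 + 1" by (simp add: sym_poly_B_def one_pCons)
    then have "theta_mom d j (sym_poly_B 1) = theta_mom d (j + 1) 1 + theta_mom d (j - 1) 1 + theta_mom d j 1" for j
      by (simp only: theta_mom_add theta_mom_X)
    then show ?thesis using 2 by (simp add: algebra_simps)
  next
    case (3 i)
    have "sym_poly_B k = [:0, 1:] * sym_poly_B (Suc i) - sym_poly_B i" using 3 by (simp add: sym_poly_B_def)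
    then have v: "theta_mom d j (sym_poly_B k) = theta_mom d (j + 1) (sym_poly_B (Suc i)) + theta_mom d (j - 1) (sym_poly_B (Suc i)) - theta_mom d j (sym_poly_B i)" for j
      by (simp only: theta_mom_diff theta_mom_X)
    have D1: "theta_mom d (j + 1) (sym_poly_B (Suc i)) - theta_mom d j (sym_poly_B (Suc i)) = theta_mom d (j + int k) 1 - theta_mom d (j - int i - 1) 1"
      using less.IH[of "Suc i" "j + 1"] by (simp add: 3 algebra_simps)
    have D2: "theta_mom d (j - 1) (sym_poly_B (Suc i)) - theta_mom d (j - 1 - 1) (sym_poly_B (Suc i)) = theta_mom d (j + int i) 1 - theta_mom d (j - int k - 1) 1"
      using less.IH[of "Suc i" "j - 1"] by (simp add: 3 algebra_simps)
    have D3: "theta_mom d j (sym_poly_B i) - theta_mom d (j - 1) (sym_poly_B i) = theta_mom d (j + int i) 1 - theta_mom d (j - int i - 1) 1"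
      using less.IH[of i j] by (simp add: 3)
    have "theta_mom d j (sym_poly_B k) - theta_mom d (j - 1) (sym_poly_B k)
      = (theta_mom d (j + 1) (sym_poly_B (Suc i)) - theta_mom d j (sym_poly_B (Suc i)))
        + (theta_mom d (j - 1) (sym_poly_B (Suc i)) - theta_mom d (j - 1 - 1) (sym_poly_B (Suc i)))
        - (theta_mom d j (sym_poly_B i) - theta_mom d (j - 1) (sym_poly_B i))"
      unfolding v by simp
    then show ?thesis unfolding D1 D2 D3 by simp
  qed
qed

text \<open>Each \<open>reflect_poly 0 N\<close> has value 1 at 2, so the differences are divisible
  by \<open>[:2, - 1:]\<close>; the quotients satisfy the same recurrence with other initial
  values.\<close>

lemma reflect_poly_diff: "reflect_poly 0 N - reflect_poly 0 (Suc N) = [:2, - 1:] * reflect_poly_B N"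
proof (induction N rule: less_induct)
  case (less N)
  consider "N = 0" | "N = 1" | M where "N = Suc (Suc M)" by (metis One_nat_def not0_implies_Suc)
  then show ?case
  proof cases
    case 3
    have "reflect_poly 0 N - reflect_poly 0 (Suc N) = [:0, 1:] * (reflect_poly 0 (Suc M) - reflect_poly 0 N) - (reflect_poly 0 M - reflect_poly 0 (Suc M))"
      by (simp add: 3 reflect_poly_def algebra_simps)
    also have "\<dots> = [:0, 1:] * ([:2, - 1:] * reflect_poly_B (Suc M)) - [:2, - 1:] * reflect_poly_B M"
      using less.IH[of "Suc M"] less.IH[of M] by (simp add: 3)
    also have "\<dots> = [:2, - 1:] * reflect_poly_B N"
      by (simp add: 3 reflect_poly_B_def algebra_simps)
    finally show ?thesis .
  qed (simp_all add: reflect_poly_def reflect_poly_B_def one_pCons)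
qed

definition col_poly_B :: "nat \<Rightarrow> complex poly" where
  "col_poly_B = three_term_poly (\<lambda>k. q powi (- int k - 1)) (\<lambda>k. 1 - q powi (- int k))"

lemma col_poly_B_rec: "col_poly_B (Suc k) = [:- (q powi (- int k - 1)), 1:] * col_poly_B k - smult (1 - q powi (- int k)) (col_poly_B (k - 1))"
  by (cases k) (simp_all add: col_poly_B_def)

text \<open>Again all \<open>col_poly 0 k\<close> have value 1 at 2. Subtracting consecutive
  recurrences gives one for the differences, with the diagonal coefficient advanced by one
  step.\<close>

lemma col_poly_diff: "col_poly 0 k - col_poly 0 (Suc k) = [:2, - 1:] * col_poly_B k"
proof (induction k rule: less_induct)
  case (less k)
  have pp0: "col_poly 0 (Suc k) = [:- (q powi (- int k)), 1:] * col_poly 0 k - smult (1 - q powi (- int k)) (col_poly 0 (k - 1))" for k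
    unfolding col_poly_rec q_powi by simp
  show ?case
  proof (cases k)
    case 0 then show ?thesis unfolding pp0 by (simp add: col_poly_def col_poly_B_def one_pCons)
  next
    case (Suc j)
    define a b where "a = q powi (- int j)" and "b = q powi (- int j - 1)"
    have ab: "q powi (- int (Suc j)) = b"
      unfolding b_def by (rule arg_cong[of _ _ "(powi) q"]) simp
    define x where "x = ([:0, 1:] :: complex poly)"
    have lin: "[:- c, 1:] = x - [:c:]" for c by (simp add: x_def)
    have sm: "smult (1 - c) p = (1 - [:c:]) * p" for c and p :: "complex poly"
      by (simp add: smult_diff_left algebra_simps)
    have p1: "col_poly 0 (Suc j) = (x - [:a:]) * col_poly 0 j - (1 - [:a:]) * col_poly 0 (j - 1)"
      unfolding pp0[of j] lin a_def[symmetric] by (simp add: smult_diff_left algebra_simps)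
    have p2: "col_poly 0 (Suc (Suc j)) = (x - [:b:]) * col_poly 0 (Suc j) - (1 - [:b:]) * col_poly 0 j"
      unfolding pp0[of "Suc j"] lin ab by (simp add: smult_diff_left algebra_simps)
    have z: "[:2, - 1:] * col_poly_B (Suc j) = (x - [:b:]) * ([:2, - 1:] * col_poly_B j) - (1 - [:a:]) * ([:2, - 1:] * col_poly_B (j - 1))"
      unfolding col_poly_B_rec lin sm a_def[symmetric] b_def[symmetric] right_diff_distrib[of "[:2, - 1:]"]
      by (simp only: mult.left_commute[of "[:2, - 1:]"])
    have "(1 - [:a:]) * ([:2, - 1:] * col_poly_B (j - 1)) = (1 - [:a:]) * (col_poly 0 (j - 1) - col_poly 0 j)"
    proof (cases j)
      case 0 then show ?thesis by (simp add: a_def)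
    next
      case (Suc i) then show ?thesis using less.IH[of i] \<open>k = Suc j\<close> by simp
    qed
    moreover have "[:2, - 1:] * col_poly_B j = col_poly 0 j - col_poly 0 (Suc j)" using less.IH[of j] Suc by simp
    ultimately have "[:2, - 1:] * col_poly_B (Suc j) = (x - [:b:]) * (col_poly 0 j - col_poly 0 (Suc j)) - (1 - [:a:]) * (col_poly 0 (j - 1) - col_poly 0 j)"
      unfolding z by simp
    also have "\<dots> = col_poly 0 (Suc j) - col_poly 0 (Suc (Suc j))"
      unfolding p2 by (subst (2) p1) (simp add: p1 algebra_simps)
    finally show ?thesis by (simp add: Suc)
  qed
qed

text \<open>The factor \<open>[:2, - 1:]\<close> turns the entry into a difference of neighbouring
  Rogers-Ramanujan sums, which \<open>rr_sum_rec\<close> contracts to a single one.\<close>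

lemma theta_mom0_row_col_B:
  "theta_mom0 0 ([:2, - 1:] * (row_poly N * col_poly_B k)) = q powi (int k - int N + 1) * rr_sum (int k - int N + 2)"
proof -
  have E: "[:2, - 1:] * (row_poly N * col_poly_B k) = row_poly N * col_poly 0 k - row_poly N * col_poly 0 (Suc k)"
    unfolding right_diff_distrib[symmetric] col_poly_diff by (simp only: mult.left_commute)
  show ?thesis
    using rr_sum_rec[of "int k - int N"] unfolding E theta_mom_diff by (simp add: theta_mom0_row_col algebra_simps)
qed

end

section \<open>Determinants\<close>

lemma three_term_poly_coeff: "coeff (three_term_poly a b k) k = 1" "i > k \<Longrightarrow> coeff (three_term_poly a b k) i = 0"
proof -
  have "coeff (three_term_poly a b k) k = 1 \<and> (\<forall>i>k. coeff (three_term_poly a b k) i = 0)"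
    by (induction k rule: induct_nat_012) (auto simp: coeff_pCons split: nat.split)
  then show "coeff (three_term_poly a b k) k = 1" "i > k \<Longrightarrow> coeff (three_term_poly a b k) i = 0" by auto
qed

lemma poly_as_sum_below:
  fixes p :: "'a::comm_ring_1 poly"
  assumes "\<And>i. i \<ge> n \<Longrightarrow> coeff p i = 0"
  shows "p = (\<Sum>i<n. smult (coeff p i) (monom 1 i))"
  using assms by (intro poly_eqI) (auto simp: coeff_sum not_less if_distrib cong: if_cong)

lemma det_upper_unitriangular:
  fixes f :: "nat \<times> nat \<Rightarrow> 'a::comm_ring_1"
  assumes "\<And>i j. j < i \<Longrightarrow> i < n \<Longrightarrow> f (i, j) = 0" and "\<And>i. i < n \<Longrightarrow> f (i, i) = 1"
  shows "Determinant.det (mat n n f) = 1"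
  using assms by (subst det_upper_triangular[of _ n]) (auto intro!: upper_triangularI simp: prod_list_diag_prod)

lemma det_mat_permutes:
  "Determinant.det (mat n n (\<lambda>(i, j). A i j)) =
     (\<Sum>p | p permutes {0..<n}. signof p * (\<Prod>i=0..<n. A i (p i)))"
proof -
  have *: "mat n n (\<lambda>(i, j). A i j) $$ (i, p i) = A i (p i)" if "p permutes {0..<n}" "i \<in> {0..<n}" for p i
    using that permutes_in_image[OF that(1), of i] by simp
  have "Determinant.det (mat n n (\<lambda>(i, j). A i j)) =
     (\<Sum>p | p permutes {0..<n}. signof p * (\<Prod>i=0..<n. mat n n (\<lambda>(i, j). A i j) $$ (i, p i)))"
    by (rule det_def') simp
  also have "\<dots> = (\<Sum>p | p permutes {0..<n}. signof p * (\<Prod>i=0..<n. A i (p i)))"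
    using * by (intro sum.cong refl arg_cong2[where f = "(*)"] prod.cong) auto
  finally show ?thesis .
qed

lemma det_scale:
  fixes A :: "nat \<Rightarrow> nat \<Rightarrow> 'a::comm_ring_1"
  shows "Determinant.det (mat n n (\<lambda>(i, j). c i * A i j * e j))
     = (\<Prod>i<n. c i) * (\<Prod>j<n. e j) * Determinant.det (mat n n (\<lambda>(i, j). A i j))"
proof -
  have E: "(\<Prod>i=0..<n. c i * A i (p i) * e (p i)) = (\<Prod>i<n. c i) * (\<Prod>j<n. e j) * (\<Prod>i=0..<n. A i (p i))"
    if "p permutes {0..<n}" for p
    using prod.permute[OF that, of e] by (simp add: prod.distrib atLeast0LessThan o_def)
  show ?thesis
    unfolding det_mat_permutes sum_distrib_left
    by (intro sum.cong refl) (simp add: E mult.left_commute)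
qed

text \<open>Expanding in monomials factors the matrix through a Hankel matrix with unitriangular factors on
  either side. The rows are indexed by \<open>n - 1 - i\<close>, which matches the order of rows in the theorem.\<close>

lemma det_monic_moments:
  fixes ell :: "complex poly \<Rightarrow> complex"
  assumes add: "\<And>p r. ell (p + r) = ell p + ell r"
    and smult: "\<And>c p. ell (smult c p) = c * ell p"
    and p: "\<And>k. coeff (p k) k = 1" "\<And>k i. i > k \<Longrightarrow> coeff (p k) i = 0"
    and r: "\<And>k. coeff (r k) k = 1" "\<And>k i. i > k \<Longrightarrow> coeff (r k) i = 0"
  shows "Determinant.det (mat n n (\<lambda>(i, j). ell (p (n - 1 - i) * r j)))
     = Determinant.det (mat n n (\<lambda>(i, j). ell (monom 1 (n - 1 - i + j))))"
proof -
  \<comment> \<open>Both indices are reversed, which makes this coefficient matrix upper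
    unitriangular.\<close>
  define L where "L = mat n n (\<lambda>(i, i'). coeff (p (n - 1 - i)) (n - 1 - i'))"
  define H where "H = mat n n (\<lambda>(i, j). ell (monom 1 (n - 1 - i + j)))"
  define U where "U = mat n n (\<lambda>(j', j). coeff (r j) j')"
  have c[simp]: "L \<in> carrier_mat n n" "H \<in> carrier_mat n n" "U \<in> carrier_mat n n"
    by (auto simp: L_def H_def U_def)
  have zero: "ell 0 = 0" using smult[of 0 0] by simp
  have sum: "ell (\<Sum>i\<in>A. f i) = (\<Sum>i\<in>A. ell (f i))" for f and A :: "nat set"
    by (induction A rule: infinite_finite_induct) (simp_all add: zero add)
  have "mat n n (\<lambda>(i, j). ell (p (n - 1 - i) * r j)) = L * (H * U)"
  proof (rule eq_matI)
    fix i j assume "i < dim_row (L * (H * U))" "j < dim_col (L * (H * U))"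
    then have ij: "i < n" "j < n" by (auto simp: L_def U_def)
    have "p (n - 1 - i) = (\<Sum>M<n. smult (coeff (p (n - 1 - i)) M) (monom 1 M))"
      by (rule poly_as_sum_below) (use p(2) ij in auto)
    also have "\<dots> = (\<Sum>i'<n. smult (coeff (p (n - 1 - i)) (n - Suc i')) (monom 1 (n - Suc i')))"
      by (rule sum.nat_diff_reindex[symmetric])
    finally have 1: "p (n - 1 - i) = (\<Sum>i'<n. smult (coeff (p (n - 1 - i)) (n - Suc i')) (monom 1 (n - Suc i')))" .
    have 2: "r j = (\<Sum>j'<n. smult (coeff (r j) j') (monom 1 j'))"
      by (rule poly_as_sum_below) (use r(2) ij in auto)
    have "ell (p (n - 1 - i) * r j) = (\<Sum>i'<n. \<Sum>j'<n. coeff (p (n - 1 - i)) (n - Suc i')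
        * (coeff (r j) j' * ell (monom 1 (n - Suc i' + j'))))"
      by (subst 1, subst 2, subst sum_product) (simp add: sum smult mult_monom mult_ac add_ac)
    also have "\<dots> = (L * (H * U)) $$ (i, j)"
      using ij by (simp add: L_def H_def U_def scalar_prod_def atLeast0LessThan sum_distrib_left mult_ac)
    finally show "mat n n (\<lambda>(i, j). ell (p (n - 1 - i) * r j)) $$ (i, j) = (L * (H * U)) $$ (i, j)"
      using ij by simp
  qed (auto simp: L_def U_def)
  moreover have "Determinant.det (L * (H * U)) = Determinant.det L * (Determinant.det H * Determinant.det U)"
    by (simp add: det_mult[of _ n] mult_carrier_mat[of _ n n])
  moreover have "Determinant.det L = 1"
    unfolding L_def by (rule det_upper_unitriangular) (auto intro!: p)
  moreover have "Determinant.det U = 1"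
    unfolding U_def by (rule det_upper_unitriangular) (auto intro!: r)
  ultimately show ?thesis by (simp add: H_def)
qed

text \<open>The monomials may be replaced by the Newton basis at the nodes, for which the matrix is triangular.\<close>

lemma det_vandermonde:
  fixes x :: "nat \<Rightarrow> complex"
  shows "Determinant.det (mat n n (\<lambda>(i, j). x i ^ j)) = (\<Prod>i<n. \<Prod>k<i. x i - x k)"
proof -
  define p where "p j = (\<Prod>k<j. [:- x k, 1:])" for j
  have p: "coeff (p k) k = 1 \<and> (\<forall>i>k. coeff (p k) i = 0)" for k
    by (induction k) (auto simp: p_def coeff_pCons mult.commute split: nat.split)
  define U where "U = mat n n (\<lambda>(j', j). coeff (p j) j')"
  define V where "V = mat n n (\<lambda>(i, j). x i ^ j)"
  define A where "A = mat n n (\<lambda>(i, j). poly (p j) (x i))"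
  have poly_p: "poly (p j) y = (\<Prod>k<j. y - x k)" for j y by (simp add: p_def poly_prod)
  have "A = V * U"
  proof (rule eq_matI)
    fix i j assume "i < dim_row (V * U)" "j < dim_col (V * U)"
    then have ij: "i < n" "j < n" by (auto simp: V_def U_def)
    have "p j = (\<Sum>k<n. smult (coeff (p j) k) (monom 1 k))"
      by (rule poly_as_sum_below) (use p ij in auto)
    then have "poly (p j) (x i) = poly (\<Sum>k<n. smult (coeff (p j) k) (monom 1 k)) (x i)"
      by (rule arg_cong)
    also have "\<dots> = (\<Sum>k<n. coeff (p j) k * x i ^ k)"
      by (simp add: poly_sum poly_monom)
    finally show "A $$ (i, j) = (V * U) $$ (i, j)"
      using ij by (simp add: A_def V_def U_def scalar_prod_def atLeast0LessThan mult_ac)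
  qed (auto simp: A_def U_def V_def)
  then have "Determinant.det A = Determinant.det V * Determinant.det U"
    by (simp add: det_mult[of _ n] V_def U_def)
  moreover have "Determinant.det U = 1"
    unfolding U_def by (rule det_upper_unitriangular) (use p in auto)
  moreover have "Determinant.det A = prod_list (diag_mat A)"
    by (rule det_lower_triangular[of n]) (auto simp: A_def poly_p)
  moreover have "prod_list (diag_mat A) = (\<Prod>i<n. \<Prod>k<i. x i - x k)"
    by (simp add: prod_list_diag_prod A_def poly_p atLeast0LessThan)
  ultimately show ?thesis by (simp add: V_def)
qed

text \<open>Absolute summability is carried through the induction because multiplying by the next
  single series requires it.\<close>

lemma has_sum_prod_PiE:
  fixes f :: "'a \<Rightarrow> 'b \<Rightarrow> complex"
  assumes "finite A" and "\<And>x. x \<in> A \<Longrightarrow> f x abs_summable_on B x"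
    and "\<And>x. x \<in> A \<Longrightarrow> (f x has_sum s x) (B x)"
  shows "(\<lambda>g. \<Prod>x\<in>A. f x (g x)) abs_summable_on PiE A B \<and>
    ((\<lambda>g. \<Prod>x\<in>A. f x (g x)) has_sum (\<Prod>x\<in>A. s x)) (PiE A B)"
  using assms
proof (induction A rule: finite_induct)
  case empty
  then show ?case by (auto intro!: has_sum_finiteI)
next
  case (insert x A)
  let ?F = "\<lambda>g. \<Prod>x\<in>A. f x (g x)"
  have IH: "?F abs_summable_on PiE A B" "(?F has_sum (\<Prod>x\<in>A. s x)) (PiE A B)"
    using insert by auto
  have x: "f x abs_summable_on B x" "(f x has_sum s x) (B x)" using insert by auto
  let ?c = "\<lambda>(y, g). g(x := y)"
  have inj: "inj_on ?c (B x \<times> PiE A B)" by (rule inj_combinator[OF insert(2)])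
  have upd: "(\<Prod>z\<in>insert x A. f z ((?c u) z)) = (case u of (y, g) \<Rightarrow> f x y * ?F g)" for u
    using insert(1,2) by (auto simp: case_prod_unfold intro!: prod.cong)
  have "(\<lambda>(y, g). f x y * ?F g) abs_summable_on B x \<times> PiE A B"
    by (rule abs_summable_prod[OF x(1) IH(1)])
  moreover have "((\<lambda>(y, g). f x y * ?F g) has_sum s x * (\<Prod>x\<in>A. s x)) (B x \<times> PiE A B)"
    by (rule has_sum_prod_abs[OF x IH])
  ultimately show ?case
    unfolding PiE_insert_eq summable_on_reindex[OF inj] has_sum_reindex[OF inj] o_def upd
    using insert(1,2) by simp
qed

lemma has_sum_finite_sum:
  fixes f :: "'a \<Rightarrow> 'b \<Rightarrow> 'c::topological_comm_monoid_add"
  assumes "\<And>a. a \<in> A \<Longrightarrow> (f a has_sum s a) B"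
  shows "((\<lambda>x. \<Sum>a\<in>A. f a x) has_sum (\<Sum>a\<in>A. s a)) B"
  using assms by (induction A rule: infinite_finite_induct) (auto intro: has_sum_add)

text \<open>Row \<open>i\<close> depends on one coordinate of the tuple only, so each product in the
  Leibniz expansion sums to a product of single series.\<close>

lemma has_sum_det:
  fixes g :: "nat \<Rightarrow> nat \<Rightarrow> nat \<Rightarrow> complex"
  assumes "\<And>i j. g i j abs_summable_on UNIV" and "\<And>i j. (g i j has_sum s i j) UNIV"
  shows "((\<lambda>l. Determinant.det (mat n n (\<lambda>(i, j). g i j (l (i + 1))))) has_sum
      Determinant.det (mat n n (\<lambda>(i, j). s i j))) (nat_tuples n)"
proof -
  have "((\<lambda>l. \<Sum>p | p permutes {0..<n}. signof p * (\<Prod>i=1..n. g (i - 1) (p (i - 1)) (l i))) has_sum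
     (\<Sum>p | p permutes {0..<n}. signof p * (\<Prod>i=1..n. s (i - 1) (p (i - 1))))) (nat_tuples n)"
    unfolding nat_tuples_def
    by (intro has_sum_finite_sum has_sum_cmult_right has_sum_prod_PiE[THEN conjunct2] assms) auto
  moreover have "(\<Prod>i=1..n. f i) = (\<Prod>i=0..<n. f (i + 1))" for f :: "nat \<Rightarrow> complex"
    using prod.shift_bounds_nat_ivl[of f 0 1 n] by (simp add: atLeastLessThanSuc_atLeastAtMost)
  ultimately show ?thesis
    by (simp add: det_mat_permutes)
qed

section \<open>The identities\<close>

lemma prod_pairs_swap:
  fixes F :: "nat \<Rightarrow> nat \<Rightarrow> complex"
  shows "(\<Prod>i=1..n. \<Prod>j=i+1..n. F i j) = (\<Prod>j<n. \<Prod>i<j. F (i + 1) (j + 1))"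
proof (induction n)
  case (Suc n)
  have "(\<Prod>i=1..Suc n. \<Prod>j=i+1..Suc n. F i j) = (\<Prod>i=1..n. \<Prod>j=i+1..Suc n. F i j)"
    by simp
  also have "\<dots> = (\<Prod>i=1..n. (\<Prod>j=i+1..n. F i j) * F i (Suc n))"
    by (rule prod.cong) auto
  also have "\<dots> = (\<Prod>j<n. \<Prod>i<j. F (i + 1) (j + 1)) * (\<Prod>i=1..n. F i (Suc n))"
    unfolding prod.distrib Suc.IH ..
  also have "(\<Prod>i=1..n. F i (Suc n)) = (\<Prod>i<n. F (i + 1) (n + 1))"
    by (simp add: prod.atLeast1_atMost_eq)
  finally show ?case by simp
qed simp

lemma prod_reverse:
  fixes f :: "nat \<Rightarrow> complex"
  shows "(\<Prod>i<n. f (n - 1 - i)) = (\<Prod>i<n. f i)"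
  using prod.nat_diff_reindex[of f n] by simp

section \<open>The multiple sum as a determinant of single sums\<close>

context nome
begin

lemma rr_sum_nat:
  "(\<lambda>L::nat. q powi ((int L)\<^sup>2 + m * int L) / qfac q L) abs_summable_on UNIV" (is "?f abs_summable_on _")
  "((\<lambda>L::nat. q powi ((int L)\<^sup>2 + m * int L) / qfac q L) has_sum rr_sum m) UNIV"
proof -
  define g where "g = (\<lambda>L. q powi (L\<^sup>2 + m * L) * rqfac q L)"
  have g: "g \<circ> int = ?f" by (auto simp: g_def rqfac_def)
  have neg: "g L = 0" if "L \<notin> range int" for L
    using that by (cases L rule: int_cases2) (auto simp: g_def rqfac_def)
  have "(\<lambda>L. norm (g L)) summable_on UNIV"
    unfolding g_def by (rule abs_summable_gauss_rqfac)
  then have "(\<lambda>L. norm (g L)) summable_on range int"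
    by (rule summable_on_subset_banach) simp
  then show "?f abs_summable_on UNIV"
    by (subst (asm) summable_on_reindex) (simp_all add: o_def fun_cong[OF g, unfolded o_def])
  have "(g has_sum rr_sum m) UNIV" unfolding g_def by (rule rr_sum_has_sum)
  then have "(g has_sum rr_sum m) (range int)"
    by (rule iffD1[OF has_sum_cong_neutral, rotated -1]) (use neg in auto)
  then show "(?f has_sum rr_sum m) UNIV"
    by (subst (asm) has_sum_reindex) (simp_all add: g)
qed

text \<open>With \<open>x_i\<close> the power of \<open>q\<close> at the \<open>i\<close>-th
  coordinate, the pair product is the Vandermonde determinant divided by the powers
  \<open>x_i^i\<close>. These factors go into the rows, and every entry is then summed
  separately.\<close>

theorem multisum_as_det:
  fixes \<delta> :: int
  shows "((\<lambda>l :: nat \<Rightarrow> nat.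
          (\<Prod>i=1..n.
             q powi ((\<delta> + int n - 1) * (int (l i) - int n + int i)
                     + (int (l i) - int n + int i) ^ 2) / qfac q (l i))
          * (\<Prod>i=1..n. \<Prod>j=i+1..n. 1 - q powi (int (l i) - int (l j))))
        has_sum
         (\<Prod>N<n. q powi (int N * int N - (\<delta> + int n - 1) * int N))
          * Determinant.det (mat n n (\<lambda>(i, j). rr_sum (\<delta> + int j - int (n - 1 - i))))) (nat_tuples n)"
proof -
  define c where "c N = q powi (int N * int N - (\<delta> + int n - 1) * int N)" for N :: nat
  define A where "A i L = q powi ((\<delta> + int n - 1) * (int L - int n + int i)
      + (int L - int n + int i) ^ 2) / qfac q L" for i L :: nat
  \<comment> \<open>Expanding the shifted square in the exponent: \<open>m\<close> is the
    coefficient of \<open>L\<close>, including the Vandermonde exponent \<open>j - i\<close>, and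
    \<open>C\<close> is the constant part.\<close>
  define m where "m i j = 2 * (int i + 1 - int n) + (\<delta> + int n - 1) + int j - int i" for i j :: nat
  define C where "C i = q powi ((int i + 1 - int n)\<^sup>2 + (\<delta> + int n - 1) * (int i + 1 - int n))" for i :: nat
  define g where "g i j L = A (i + 1) L * q powi ((int j - int i) * int L)" for i j L :: nat
  have g: "g i j = (\<lambda>L. C i * (q powi ((int L)\<^sup>2 + m i j * int L) / qfac q L))" for i j
  proof
    fix L
    have "q powi ((\<delta> + int n - 1) * (int L - int n + int (i + 1)) + (int L - int n + int (i + 1)) ^ 2)
        * q powi ((int j - int i) * int L)
      = C i * q powi ((int L)\<^sup>2 + m i j * int L)"
      unfolding C_def m_def by (simp add: power_int_add_nz algebra_simps power2_eq_square)
    then show "g i j L = C i * (q powi ((int L)\<^sup>2 + m i j * int L) / qfac q L)"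
      unfolding g_def A_def by (simp add: algebra_simps)
  qed
  have det: "(\<Prod>i=1..n. A i (l i)) * (\<Prod>i=1..n. \<Prod>j=i+1..n. 1 - q powi (int (l i) - int (l j)))
      = Determinant.det (mat n n (\<lambda>(i, j). g i j (l (i + 1))))" for l :: "nat \<Rightarrow> nat"
  proof -
    define x where "x i = q powi int (l (i + 1))" for i
    have x: "x i \<noteq> 0" for i by (simp add: x_def)
    have "g i j (l (i + 1)) = (A (i + 1) (l (i + 1)) / x i ^ i) * x i ^ j * 1" for i j
    proof -
      have "q powi ((int j - int i) * int (l (i + 1))) = x i ^ j / x i ^ i"
        unfolding x_def left_diff_distrib mult.commute[of _ "int (l (i + 1))"]
        by (simp add: power_int_diff power_int_mult del: power_int_of_nat) simp
      then show ?thesis by (simp add: g_def)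
    qed
    then have "Determinant.det (mat n n (\<lambda>(i, j). g i j (l (i + 1))))
       = (\<Prod>i<n. A (i + 1) (l (i + 1)) / x i ^ i) * (\<Prod>j<n. 1) * (\<Prod>i<n. \<Prod>k<i. x i - x k)"
      by (simp only: det_scale det_vandermonde)
    also have "\<dots> = (\<Prod>i<n. A (i + 1) (l (i + 1))) * (\<Prod>i<n. (\<Prod>k<i. x i - x k) / x i ^ i)"
      by (simp add: prod_dividef)
    also have "(\<Prod>i<n. (\<Prod>k<i. x i - x k) / x i ^ i) = (\<Prod>i<n. \<Prod>k<i. (x i - x k) / x i)"
      by (simp add: prod_dividef)
    also have "\<dots> = (\<Prod>i<n. \<Prod>k<i. 1 - q powi (int (l (k + 1)) - int (l (i + 1))))"
    proof (intro prod.cong refl)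
      fix i k
      have "q powi (int (l (k + 1)) - int (l (i + 1))) = x k / x i"
        unfolding x_def by (simp add: power_int_diff)
      then show "(x i - x k) / x i = 1 - q powi (int (l (k + 1)) - int (l (i + 1)))"
        using x[of i] by (simp add: diff_divide_distrib)
    qed
    also have "\<dots> = (\<Prod>i=1..n. \<Prod>j=i+1..n. 1 - q powi (int (l i) - int (l j)))"
      by (rule prod_pairs_swap[symmetric])
    also have "(\<Prod>i<n. A (i + 1) (l (i + 1))) = (\<Prod>i=1..n. A i (l i))"
      by (simp add: prod.atLeast1_atMost_eq)
    finally show ?thesis ..
  qed
  have "((\<lambda>l. Determinant.det (mat n n (\<lambda>(i, j). g i j (l (i + 1))))) has_sum
      Determinant.det (mat n n (\<lambda>(i, j). C i * rr_sum (m i j)))) (nat_tuples n)"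
  proof (rule has_sum_det)
    show "(g i j has_sum C i * rr_sum (m i j)) UNIV" for i j
      unfolding g by (intro has_sum_cmult_right rr_sum_nat)
    show "g i j abs_summable_on UNIV" for i j
      unfolding g norm_mult by (intro summable_on_cmult_right rr_sum_nat)
  qed
  moreover have "Determinant.det (mat n n (\<lambda>(i, j). C i * rr_sum (m i j)))
     = (\<Prod>N<n. c N) * Determinant.det (mat n n (\<lambda>(i, j). rr_sum (\<delta> + int j - int (n - 1 - i))))"
  proof -
    \<comment> \<open>In terms of \<open>N = n - 1 - i\<close> one has
      \<open>i + 1 - n = - N\<close>, so \<open>C i\<close> is \<open>c N\<close> and
      \<open>m i j\<close> is \<open>\<delta> + j - N\<close>.\<close>
    have "mat n n (\<lambda>(i, j). C i * rr_sum (m i j))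
      = mat n n (\<lambda>(i, j). c (n - 1 - i) * rr_sum (\<delta> + int j - int (n - 1 - i)) * 1)"
    proof (rule eq_matI, goal_cases)
      case (1 i j)
      then have N: "int (n - 1 - i) = int n - 1 - int i" by auto
      show ?case using 1 unfolding c_def C_def m_def N
        by (simp add: algebra_simps power2_eq_square N)
    qed auto
    then show ?thesis by (simp only: det_scale prod_reverse) simp
  qed
  ultimately show ?thesis unfolding det[unfolded A_def, symmetric] c_def by simp
qed

end

section \<open>Collecting signs and exponents\<close>

lemma prod_powi: "(h::complex) \<noteq> 0 \<Longrightarrow> (\<Prod>i\<in>A. h powi f i) = h powi (\<Sum>i\<in>A. f i)"
  by (induction A rule: infinite_finite_induct) (simp_all add: power_int_add)

lemma prod_minus_one_powi: "(\<Prod>N<n. (- 1) powi int N :: complex) = (- 1) ^ (n choose 2)"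
  by (induction n) (simp_all add: numeral_2_eq_2 power_add)

lemma sum_int_lessThan: "2 * (\<Sum>N<n. int N) = int n * (int n - 1)"
  by (induction n) (auto simp: algebra_simps)

text \<open>This form is what equates the total exponent of the theta rows with that of the
  Vandermonde reduction.\<close>

lemma sum_int_square_lessThan: "3 * (\<Sum>N<n. int N * int N) = (2 * int n - 1) * (\<Sum>N<n. int N)"
proof (induction n)
  case (Suc n)
  define S where "S = (\<Sum>N<n. int N * int N)"
  define s where "s = (\<Sum>N<n. int N)"
  have "3 * S = (2 * int n - 1) * s" "2 * s = int n * (int n - 1)"
    using Suc.IH sum_int_lessThan[of n] by (simp_all add: S_def s_def)
  moreover have "3 * (S + int n * int n) - 3 * S + ((2 * int n - 1) * s) =
      (2 * (1 + int n) - 1) * (s + int n) + (int n * (int n - 1) - 2 * s)"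
    by (simp add: algebra_simps)
  ultimately have "3 * (S + int n * int n) = (2 * (1 + int n) - 1) * (s + int n)" by linarith
  then show ?case unfolding sum.lessThan_Suc of_nat_Suc S_def s_def .
qed simp

context sqrt_nome
begin

text \<open>Both determinants equal the Hankel determinant of the functional
  \<open>p \<mapsto> theta_mom d k (u * p)\<close>; the fixed factor \<open>u\<close> is 1 for
  \<open>D_n\<close> and \<open>[:2, - 1:]\<close> for \<open>B_n\<close>.\<close>

lemma det_theta_mom_monic:
  assumes p: "p = three_term_poly a b" and r: "r = three_term_poly c e" and p': "p' = three_term_poly a' b'" and r': "r' = three_term_poly c' e'"
  shows "Determinant.det (mat n n (\<lambda>(i, j). theta_mom d k (u * (p (n - 1 - i) * r j))))
       = Determinant.det (mat n n (\<lambda>(i, j). theta_mom d k (u * (p' (n - 1 - i) * r' j))))"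
proof -
  define F where "F p = theta_mom d k (u * p)" for p
  have F: "F (p + r) = F p + F r" "F (smult c p) = c * F p" for p r c
    by (simp_all add: F_def distrib_left theta_mom_add theta_mom_smult)
  show ?thesis unfolding F_def[symmetric] p r p' r'
    using det_monic_moments[of F "three_term_poly a b" "three_term_poly c e", OF F three_term_poly_coeff three_term_poly_coeff]
          det_monic_moments[of F "three_term_poly a' b'" "three_term_poly c' e'", OF F three_term_poly_coeff three_term_poly_coeff] by simp
qed

text \<open>The theta moments are those of \<open>reflect_poly\<close> and \<open>sym_poly\<close>;
  exchanging these families for \<open>row_poly\<close> and \<open>col_poly\<close> leaves
  Rogers-Ramanujan sums up to row and column factors.\<close>

lemma det_theta_D:
  assumes d: "d \<le> 1" and n: "n \<ge> 1"
  shows "Determinant.det (mat n n (\<lambda>(i, j). theta_mom d (int j - int (n - 1 - i)) 1 + theta_mom d (- int j - int (n - 1 - i)) 1))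
     = 2 * Determinant.det (mat n n (\<lambda>(i, j). rr_sum (int d + int j - int (n - 1 - i))))"
proof -
  have E: "theta_mom d 0 (1 * (row_poly (n - 1 - i) * col_poly d j)) = h powi (- (int d * int (n - 1 - i)))
       * rr_sum (int d + int j - int (n - 1 - i)) * h powi (int d * int j)" for i j
    unfolding mult_1_left theta_mom0_row_col[OF d] right_diff_distrib[of "int d"]
    using h_add[of "- (int d * int (n - 1 - i))" "int d * int j"] by (simp add: mult_ac)
  have e: "theta_mom d (int j - int (n - 1 - i)) 1 + theta_mom d (- int j - int (n - 1 - i)) 1
      = 1 * theta_mom d 0 (1 * (reflect_poly d (n - 1 - i) * sym_poly j)) * (if j = 0 then 2 else 1)" for i j
  proof -
    have e: "int j - int (n - 1 - i) = - int (n - 1 - i) + int j"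
      "- int j - int (n - 1 - i) = - int (n - 1 - i) - int j" by simp_all
    show ?thesis unfolding e theta_mom_sym_poly theta_mom_reflect_poly[OF d] by (simp add: mult.commute)
  qed
  have "Determinant.det (mat n n (\<lambda>(i, j). theta_mom d (int j - int (n - 1 - i)) 1 + theta_mom d (- int j - int (n - 1 - i)) 1))
     = (\<Prod>i<n. 1) * (\<Prod>j<n. if j = 0 then 2 else 1)
        * Determinant.det (mat n n (\<lambda>(i, j). theta_mom d 0 (1 * (reflect_poly d (n - 1 - i) * sym_poly j))))"
    unfolding e by (rule det_scale)
  \<comment> \<open>The column \<open>j = 0\<close>, present as \<open>n \<ge> 1\<close>,
    contributes the only factor 2.\<close>
  also have "(\<Prod>j<n. if j = 0 then 2 else (1::complex)) = 2"
    using n by (simp add: prod.delta)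
  also have "Determinant.det (mat n n (\<lambda>(i, j). theta_mom d 0 (1 * (reflect_poly d (n - 1 - i) * sym_poly j))))
     = Determinant.det (mat n n (\<lambda>(i, j). theta_mom d 0 (1 * (row_poly (n - 1 - i) * col_poly d j))))"
    by (rule det_theta_mom_monic[OF reflect_poly_def sym_poly_def row_poly_def col_poly_def])
  also have "Determinant.det (mat n n (\<lambda>(i, j). theta_mom d 0 (1 * (row_poly (n - 1 - i) * col_poly d j))))
     = Determinant.det (mat n n (\<lambda>(i, j). h powi (- (int d * int (n - 1 - i)))
       * rr_sum (int d + int j - int (n - 1 - i)) * h powi (int d * int j)))"
    by (simp only: E)
  also have "Determinant.det (mat n n (\<lambda>(i, j). h powi (- (int d * int (n - 1 - i)))
       * rr_sum (int d + int j - int (n - 1 - i)) * h powi (int d * int j)))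
     = (\<Prod>i<n. h powi (- (int d * int (n - 1 - i)))) * (\<Prod>j<n. h powi (int d * int j))
        * Determinant.det (mat n n (\<lambda>(i, j). rr_sum (int d + int j - int (n - 1 - i))))"
    by (rule det_scale)
  \<comment> \<open>Rows and columns run over the same indices, so their opposite powers of
    \<open>h\<close> cancel.\<close>
  also have "(\<Prod>i<n. h powi (- (int d * int (n - 1 - i)))) * (\<Prod>j<n. h powi (int d * int j)) = 1"
    unfolding prod_reverse[of "\<lambda>N. h powi (- (int d * int N))"]
    by (simp add: prod_powi sum_negf h_add del: power_int_of_nat)
  finally show ?thesis by simp
qed

text \<open>Under the functional \<open>X^(-N) - X^(-N-1)\<close> acts as
  \<open>[:2, - 1:] * reflect_poly_B N\<close>, so the exchange of families takes place behind this
  common factor.\<close>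

lemma det_theta_B:
  "Determinant.det (mat n n (\<lambda>(i, j). theta_mom 0 (int j - int (n - 1 - i)) 1 - theta_mom 0 (- 1 - int j - int (n - 1 - i)) 1))
     = q ^ n * Determinant.det (mat n n (\<lambda>(i, j). rr_sum (2 + int j - int (n - 1 - i))))"
proof -
  have E: "theta_mom 0 0 ([:2, - 1:] * (row_poly (n - 1 - i) * col_poly_B j)) = q powi (1 - int (n - 1 - i))
       * rr_sum (2 + int j - int (n - 1 - i)) * q powi (int j)" for i j
  proof -
    have e: "int j - int (n - 1 - i) + 1 = 1 - int (n - 1 - i) + int j"
      "int j - int (n - 1 - i) + 2 = 2 + int j - int (n - 1 - i)" by simp_all
    show ?thesis
      unfolding theta_mom0_row_col_B e power_int_add_nz[OF q_neq_0, symmetric] by (simp only: mult_ac)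
  qed
  have "theta_mom 0 (int j - int N) 1 - theta_mom 0 (- 1 - int j - int N) 1 = theta_mom 0 0 ([:2, - 1:] * (reflect_poly_B N * sym_poly_B j))" for N j
  proof -
    have "theta_mom 0 (int j - int N) 1 - theta_mom 0 (- 1 - int j - int N) 1
       = theta_mom 0 (- int N) (sym_poly_B j) - theta_mom 0 (- int (Suc N)) (sym_poly_B j)"
    proof -
      have e: "int j - int N = - int N + int j" "- 1 - int j - int N = - int N - int j - 1"
        "- int (Suc N) = - int N - 1" by simp_all
      show ?thesis unfolding e by (rule theta_mom_sym_poly_B)
    qed
    also have "\<dots> = theta_mom0 0 ((reflect_poly 0 N - reflect_poly 0 (Suc N)) * sym_poly_B j)"
      unfolding left_diff_distrib theta_mom_diff by (simp only: theta_mom_reflect_poly zero_le_one)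
    finally show ?thesis unfolding reflect_poly_diff by (simp only: mult.assoc)
  qed
  then have "Determinant.det (mat n n (\<lambda>(i, j). theta_mom 0 (int j - int (n - 1 - i)) 1 - theta_mom 0 (- 1 - int j - int (n - 1 - i)) 1))
     = Determinant.det (mat n n (\<lambda>(i, j). theta_mom 0 0 ([:2, - 1:] * (reflect_poly_B (n - 1 - i) * sym_poly_B j))))"
    by (simp only:)
  also have "\<dots> = Determinant.det (mat n n (\<lambda>(i, j). theta_mom 0 0 ([:2, - 1:] * (row_poly (n - 1 - i) * col_poly_B j))))"
    by (rule det_theta_mom_monic[OF reflect_poly_B_def sym_poly_B_def row_poly_def col_poly_B_def])
  also have "\<dots> = Determinant.det (mat n n (\<lambda>(i, j). q powi (1 - int (n - 1 - i))
       * rr_sum (2 + int j - int (n - 1 - i)) * q powi (int j)))"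
    by (simp only: E)
  also have "Determinant.det (mat n n (\<lambda>(i, j). q powi (1 - int (n - 1 - i))
       * rr_sum (2 + int j - int (n - 1 - i)) * q powi (int j)))
     = (\<Prod>i<n. q powi (1 - int (n - 1 - i))) * (\<Prod>j<n. q powi (int j))
        * Determinant.det (mat n n (\<lambda>(i, j). rr_sum (2 + int j - int (n - 1 - i))))"
    by (rule det_scale)
  \<comment> \<open>The exponents \<open>1 - N\<close> and \<open>j\<close> over
    \<open>0..n-1\<close> add up to \<open>n\<close>.\<close>
  also have "(\<Prod>i<n. q powi (1 - int (n - 1 - i))) * (\<Prod>j<n. q powi (int j)) = q ^ n"
    unfolding prod_reverse[of "\<lambda>N. q powi (1 - int N)"]
    by (simp only: prod_powi q_neq_0 not_False_eq_True power_int_add_nz) (simp add: sum_subtractf)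
  finally show ?thesis .
qed

text \<open>Each row gives up its factor from \<open>theta_entry_D\<close>. The 2 of
  \<open>det_theta_D\<close> cancels \<open>1 / 2\<close>, and the row signs multiply to the sign in
  front, which they cancel.\<close>

lemma rhs_D:
  assumes d: "d \<le> 1" and n: "n \<ge> 1"
  shows "1 / 2 * (- 1) ^ (n choose 2)
           * (\<Prod>i=1..n.
                qpoch_inf (q ^ 5) (q ^ 5) / qpoch_inf q q
                * h powi ((int n - int i) * (2 * (int n - int i) + int d)))
           * det_upto n (\<lambda>i j.
               h powi ((int j - 1) * (2 * (int n - int i) + int d))
               * qtheta (q powi (4 * int n + 2 * int d + 1 - 4 * int i + int j)) (q ^ 5)
               + h powi (- ((int j - 1) * (2 * (int n - int i) + int d)))
               * qtheta (q powi (4 * int n + 2 * int d + 3 - 4 * int i - int j)) (q ^ 5))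
     = (\<Prod>N<n. q powi (int N * int N - (int d + int n - 1) * int N))
        * Determinant.det (mat n n (\<lambda>(i, j). rr_sum (int d + int j - int (n - 1 - i))))"
proof -
  define Q where "Q = qpoch_inf (q ^ 5) (q ^ 5) / qpoch_inf q q"
  define E where "E i j = h powi ((int j - 1) * (2 * (int n - int i) + int d))
               * qtheta (q powi (4 * int n + 2 * int d + 1 - 4 * int i + int j)) (q ^ 5)
               + h powi (- ((int j - 1) * (2 * (int n - int i) + int d)))
               * qtheta (q powi (4 * int n + 2 * int d + 3 - 4 * int i - int j)) (q ^ 5)" for i j :: nat
  define c where "c i = Q * h powi ((int n - int i) * (2 * (int n - int i) + int d))" for i :: nat
  define s where "s N = (- 1) powi int N * h powi (- (int N * int N) + int N - 2 * int d * int N)" for N :: nat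
  define D where "D = Determinant.det (mat n n (\<lambda>(i, j). rr_sum (int d + int j - int (n - 1 - i))))"
  have "(\<Prod>i=1..n. c i) * det_upto n E = (\<Prod>i<n. c (i + 1)) * (\<Prod>j<n. 1) * Determinant.det (mat n n (\<lambda>(i, j). E (i + 1) (j + 1)))"
    by (simp add: det_upto_def prod.atLeast1_atMost_eq)
  also have "\<dots> = Determinant.det (mat n n (\<lambda>(i, j). c (i + 1) * E (i + 1) (j + 1) * 1))"
    by (rule det_scale[symmetric])
  also have "mat n n (\<lambda>(i, j). c (i + 1) * E (i + 1) (j + 1) * 1) = mat n n (\<lambda>(i, j).
      s (n - 1 - i) * (theta_mom d (int j - int (n - 1 - i)) 1 + theta_mom d (- int j - int (n - 1 - i)) 1) * 1)"
  proof (rule eq_matI, goal_cases)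
    case (1 i j)
    then have ij: "i < n" "j < n" by auto
    \<comment> \<open>Counting \<open>i\<close> from 0, this is \<open>n - i\<close> in the
      numbering from 1.\<close>
    define N where "N = int (n - 1 - i)"
    have N: "int n - int (i + 1) = N" using ij by (simp add: N_def)
    have e: "4 * int n + 2 * int d + 1 - 4 * int (i + 1) + int (j + 1) = 4 * N + 2 * int d + 2 + int j"
      "4 * int n + 2 * int d + 3 - 4 * int (i + 1) - int (j + 1) = 4 * N + 2 * int d + 2 + - int j"
      "int (j + 1) - 1 = int j"
      using N by auto
    have "c (i + 1) * E (i + 1) (j + 1)
      = h powi (N * (2 * N + int d)) * (h powi (int j * (2 * N + int d)) * norm_theta (4 * N + 2 * int d + 2 + int j))
      + h powi (N * (2 * N + int d)) * (h powi ((- int j) * (2 * N + int d)) * norm_theta (4 * N + 2 * int d + 2 + - int j))"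
      unfolding c_def E_def N e norm_theta_def Q_def[symmetric] mult_minus_left by (simp only: distrib_left mult_ac)
    also have "\<dots> = s (n - 1 - i) * (theta_mom d (int j - N) 1 + theta_mom d (- int j - N) 1)"
      unfolding theta_entry_D s_def N_def[symmetric] by (simp only: distrib_left)
    finally show ?case using ij by (simp add: N_def)
  qed auto
  also have "Determinant.det \<dots> = (\<Prod>i<n. s (n - 1 - i)) * (\<Prod>j<n. 1) * (2 * D)"
    unfolding det_scale det_theta_D[OF d n] D_def ..
  also have "(\<Prod>i<n. s (n - 1 - i)) = (\<Prod>i<n. s i)" by (rule prod_reverse)
  also have "\<dots> = (- 1) ^ (n choose 2) * (\<Prod>N<n. q powi (int N * int N - (int d + int n - 1) * int N))"
  proof -
    \<comment> \<open>The two families of exponents are compared in total rather than row by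
      row.\<close>
    have "(\<Sum>N<n. - (int N * int N) + int N - 2 * int d * int N)
        = - (\<Sum>N<n. int N * int N) + (\<Sum>N<n. int N) - 2 * int d * (\<Sum>N<n. int N)"
      by (simp add: sum_subtractf sum.distrib sum_negf sum_distrib_left)
    also have "\<dots> = 2 * ((\<Sum>N<n. int N * int N) - (int d + int n - 1) * (\<Sum>N<n. int N))"
      using sum_int_square_lessThan[of n] by (simp add: algebra_simps)
    also have "\<dots> = (\<Sum>N<n. 2 * (int N * int N - (int d + int n - 1) * int N))"
      by (simp add: sum_subtractf sum_distrib_left right_diff_distrib)
    finally have "(\<Sum>N<n. - (int N * int N) + int N - 2 * int d * int N)
       = (\<Sum>N<n. 2 * (int N * int N - (int d + int n - 1) * int N))" .
    then show ?thesis unfolding s_def prod.distrib prod_minus_one_powi q_powi by (simp add: prod_powi)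
  qed
  finally have *: "(\<Prod>i=1..n. c i) * det_upto n E = (- 1) ^ (n choose 2)
      * (\<Prod>N<n. q powi (int N * int N - (int d + int n - 1) * int N)) * (\<Prod>j<n. 1) * (2 * D)" .
  have "(- 1) ^ (n choose 2) * (- 1) ^ (n choose 2) = (1::complex)"
    by (simp flip: power_mult_distrib)
  then have "1 / 2 * (- 1) ^ (n choose 2) * ((\<Prod>i=1..n. c i) * det_upto n E)
    = (\<Prod>N<n. q powi (int N * int N - (int d + int n - 1) * int N)) * D"
    unfolding * by (simp flip: mult.assoc)
  then show ?thesis unfolding c_def E_def Q_def D_def by (simp only: mult.assoc)
qed

lemma rhs_B:
  "(- 1) ^ ((n choose 2) + n)
          * (\<Prod>i=1..n.
               qpoch_inf (q ^ 5) (q ^ 5) / qpoch_inf q q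
               * h powi ((2 * (int n - int i) + 1) * (int n - int i + 1)))
          * det_upto n (\<lambda>i j.
              h powi ((2 * int j - 1) * (int n - int i + 1))
              * qtheta (q powi (6 + 4 * int n - 4 * int i + int j)) (q ^ 5)
              - h powi (- ((2 * int j - 1) * (int n - int i + 1)))
              * qtheta (q powi (7 + 4 * int n - 4 * int i - int j)) (q ^ 5))
     = (\<Prod>N<n. q powi (int N * int N - (2 + int n - 1) * int N))
        * Determinant.det (mat n n (\<lambda>(i, j). rr_sum (2 + int j - int (n - 1 - i))))"
proof -
  define Q where "Q = qpoch_inf (q ^ 5) (q ^ 5) / qpoch_inf q q"
  define E where "E i j = h powi ((2 * int j - 1) * (int n - int i + 1))
              * qtheta (q powi (6 + 4 * int n - 4 * int i + int j)) (q ^ 5)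
              - h powi (- ((2 * int j - 1) * (int n - int i + 1)))
              * qtheta (q powi (7 + 4 * int n - 4 * int i - int j)) (q ^ 5)" for i j :: nat
  define c where "c i = Q * h powi ((2 * (int n - int i) + 1) * (int n - int i + 1))" for i :: nat
  define s where "s N = (- 1) powi (int N + 1) * h powi (- (int N * int N) - 3 * int N - 2)" for N :: nat
  define D where "D = Determinant.det (mat n n (\<lambda>(i, j). rr_sum (2 + int j - int (n - 1 - i))))"
  have "(\<Prod>i=1..n. c i) * det_upto n E = (\<Prod>i<n. c (i + 1)) * (\<Prod>j<n. 1) * Determinant.det (mat n n (\<lambda>(i, j). E (i + 1) (j + 1)))"
    by (simp add: det_upto_def prod.atLeast1_atMost_eq)
  also have "\<dots> = Determinant.det (mat n n (\<lambda>(i, j). c (i + 1) * E (i + 1) (j + 1) * 1))"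
    by (rule det_scale[symmetric])
  also have "mat n n (\<lambda>(i, j). c (i + 1) * E (i + 1) (j + 1) * 1) = mat n n (\<lambda>(i, j).
      s (n - 1 - i) * (theta_mom 0 (int j - int (n - 1 - i)) 1 - theta_mom 0 (- 1 - int j - int (n - 1 - i)) 1) * 1)"
  proof (rule eq_matI, goal_cases)
    case (1 i j)
    then have ij: "i < n" "j < n" by auto
    define N where "N = int (n - 1 - i)"
    have N: "int n - int (i + 1) = N" using ij by (simp add: N_def)
    \<comment> \<open>The second theta term is the first one with \<open>j\<close> replaced by
      \<open>- 1 - j\<close>, so \<open>theta_entry_B\<close> covers both.\<close>
    have e: "6 + 4 * int n - 4 * int (i + 1) + int (j + 1) = 4 * N + 7 + int j"
      "7 + 4 * int n - 4 * int (i + 1) - int (j + 1) = 4 * N + 7 + (- 1 - int j)"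
      "2 * int (j + 1) - 1 = 2 * int j + 1" "- ((2 * int j + 1) * (N + 1)) = (2 * (- 1 - int j) + 1) * (N + 1)"
      using N by (auto simp: algebra_simps)
    have "c (i + 1) * E (i + 1) (j + 1)
      = h powi ((2 * N + 1) * (N + 1)) * (h powi ((2 * int j + 1) * (N + 1)) * norm_theta (4 * N + 7 + int j))
      - h powi ((2 * N + 1) * (N + 1)) * (h powi ((2 * (- 1 - int j) + 1) * (N + 1)) * norm_theta (4 * N + 7 + (- 1 - int j)))"
      unfolding c_def E_def N e norm_theta_def Q_def[symmetric] by (simp only: right_diff_distrib[of "_ :: complex"] mult_ac)
    also have "\<dots> = s (n - 1 - i) * (theta_mom 0 (int j - N) 1 - theta_mom 0 (- 1 - int j - N) 1)"
      unfolding theta_entry_B s_def N_def[symmetric] by (simp only: right_diff_distrib)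
    finally show ?case using ij by (simp add: N_def)
  qed auto
  also have "Determinant.det \<dots> = (\<Prod>i<n. s (n - 1 - i)) * (\<Prod>j<n. 1) * (q ^ n * D)"
    unfolding det_scale det_theta_B D_def ..
  also have "(\<Prod>i<n. s (n - 1 - i)) = (\<Prod>i<n. s i)" by (rule prod_reverse)
  also have "\<dots> * (\<Prod>j<n. 1) * (q ^ n * D) = (- 1) ^ ((n choose 2) + n)
      * ((\<Prod>N<n. q powi (int N * int N - (2 + int n - 1) * int N)) * D)"
  proof -
    have 1: "(\<Prod>N<n. (- 1) powi (int N + 1) :: complex) = (- 1) ^ ((n choose 2) + n)"
    proof -
      have "(\<Prod>N<n. (- 1) powi (int N + 1) :: complex) = (\<Prod>N<n. (- 1) powi int N * (- 1))"
        by (simp add: power_int_add_1 del: power_int_of_nat)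
      then show ?thesis unfolding prod.distrib prod_minus_one_powi by (simp add: power_add)
    qed
    \<comment> \<open>The power \<open>q ^ n\<close> from \<open>det_theta_B\<close> contributes
      \<open>2 * int n\<close> in powers of \<open>h\<close> and absorbs the constant -2 of every
      row.\<close>
    have "(\<Sum>N<n. - (int N * int N) - 3 * int N - 2) + 2 * int n
        = - (\<Sum>N<n. int N * int N) - 3 * (\<Sum>N<n. int N)"
      by (simp add: sum_subtractf sum_negf sum_distrib_left)
    also have "\<dots> = 2 * ((\<Sum>N<n. int N * int N) - (2 + int n - 1) * (\<Sum>N<n. int N))"
      using sum_int_square_lessThan[of n] by (simp add: algebra_simps)
    also have "\<dots> = (\<Sum>N<n. 2 * (int N * int N - (2 + int n - 1) * int N))"
      by (simp add: sum_subtractf sum_distrib_left right_diff_distrib)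
    finally have "(\<Sum>N<n. - (int N * int N) - 3 * int N - 2) + 2 * int n
       = (\<Sum>N<n. 2 * (int N * int N - (2 + int n - 1) * int N))" .
    then have "(\<Prod>N<n. h powi (- (int N * int N) - 3 * int N - 2)) * q powi int n
      = (\<Prod>N<n. q powi (int N * int N - (2 + int n - 1) * int N))"
      unfolding q_powi by (simp only: prod_powi h_neq_0 not_False_eq_True h_add)
    then show ?thesis unfolding s_def prod.distrib 1 by (simp flip: mult.assoc)
  qed
  finally have *: "(\<Prod>i=1..n. c i) * det_upto n E = (- 1) ^ ((n choose 2) + n)
      * ((\<Prod>N<n. q powi (int N * int N - (2 + int n - 1) * int N)) * D)" .
  have "(- 1) ^ ((n choose 2) + n) * (- 1) ^ ((n choose 2) + n) = (1::complex)"
    by (simp flip: power_mult_distrib)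
  then have "(- 1) ^ ((n choose 2) + n) * ((\<Prod>i=1..n. c i) * det_upto n E)
    = (\<Prod>N<n. q powi (int N * int N - (2 + int n - 1) * int N)) * D"
    unfolding * by (simp flip: mult.assoc)
  then show ?thesis unfolding c_def E_def Q_def D_def by (simp only: mult.assoc)
qed

end

theorem theorem4p9:
  fixes n :: nat and q h :: complex
  assumes n: "n \<ge> 1"
    and q: "0 < norm q" "norm q < 1"
    and h: "h ^ 2 = q"
  shows
    "(\<forall>\<delta>\<in>{0, 1 :: nat}.
       ((\<lambda>l :: nat \<Rightarrow> nat.
          (\<Prod>i=1..n.
             q powi ((int \<delta> + int n - 1) * (int (l i) - int n + int i)
                     + (int (l i) - int n + int i) ^ 2) / qfac q (l i))
          * (\<Prod>i=1..n. \<Prod>j=i+1..n. 1 - q powi (int (l i) - int (l j))))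
        has_sum
          (1 / 2 * (- 1) ^ (n choose 2)
           * (\<Prod>i=1..n.
                qpoch_inf (q ^ 5) (q ^ 5) / qpoch_inf q q
                * h powi ((int n - int i) * (2 * (int n - int i) + int \<delta>)))
           * det_upto n (\<lambda>i j.
               h powi ((int j - 1) * (2 * (int n - int i) + int \<delta>))
               * qtheta (q powi (4 * int n + 2 * int \<delta> + 1 - 4 * int i + int j)) (q ^ 5)
               + h powi (- ((int j - 1) * (2 * (int n - int i) + int \<delta>)))
               * qtheta (q powi (4 * int n + 2 * int \<delta> + 3 - 4 * int i - int j)) (q ^ 5))))
       (nat_tuples n))
     \<and>
     ((\<lambda>l :: nat \<Rightarrow> nat.
         (\<Prod>i=1..n.
            q powi ((1 + int n) * (int (l i) - int n + int i)
                    + (int (l i) - int n + int i) ^ 2) / qfac q (l i))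
         * (\<Prod>i=1..n. \<Prod>j=i+1..n. 1 - q powi (int (l i) - int (l j))))
       has_sum
         ((- 1) ^ ((n choose 2) + n)
          * (\<Prod>i=1..n.
               qpoch_inf (q ^ 5) (q ^ 5) / qpoch_inf q q
               * h powi ((2 * (int n - int i) + 1) * (int n - int i + 1)))
          * det_upto n (\<lambda>i j.
              h powi ((2 * int j - 1) * (int n - int i + 1))
              * qtheta (q powi (6 + 4 * int n - 4 * int i + int j)) (q ^ 5)
              - h powi (- ((2 * int j - 1) * (int n - int i + 1)))
              * qtheta (q powi (7 + 4 * int n - 4 * int i - int j)) (q ^ 5))))
      (nat_tuples n)"
proof -
  interpret sqrt_nome q h by unfold_locales (use q h in auto)
  \<comment> \<open>Matches the \<open>B_n\<close> exponent with \<open>multisum_as_det\<close> at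
    \<open>\<delta> = 2\<close>.\<close>
  have B: "1 + int n = 2 + int n - 1" by simp
  show ?thesis
  proof (intro conjI ballI)
    fix \<delta> :: nat assume "\<delta> \<in> {0, 1}"
    then have d: "\<delta> \<le> 1" by auto
    show "((\<lambda>l :: nat \<Rightarrow> nat.
          (\<Prod>i=1..n.
             q powi ((int \<delta> + int n - 1) * (int (l i) - int n + int i)
                     + (int (l i) - int n + int i) ^ 2) / qfac q (l i))
          * (\<Prod>i=1..n. \<Prod>j=i+1..n. 1 - q powi (int (l i) - int (l j))))
        has_sum
          (1 / 2 * (- 1) ^ (n choose 2)
           * (\<Prod>i=1..n.
                qpoch_inf (q ^ 5) (q ^ 5) / qpoch_inf q q
                * h powi ((int n - int i) * (2 * (int n - int i) + int \<delta>)))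
           * det_upto n (\<lambda>i j.
               h powi ((int j - 1) * (2 * (int n - int i) + int \<delta>))
               * qtheta (q powi (4 * int n + 2 * int \<delta> + 1 - 4 * int i + int j)) (q ^ 5)
               + h powi (- ((int j - 1) * (2 * (int n - int i) + int \<delta>)))
               * qtheta (q powi (4 * int n + 2 * int \<delta> + 3 - 4 * int i - int j)) (q ^ 5))))
       (nat_tuples n)"
      unfolding rhs_D[OF d n] by (rule multisum_as_det)
  next
    show "((\<lambda>l :: nat \<Rightarrow> nat.
         (\<Prod>i=1..n.
            q powi ((1 + int n) * (int (l i) - int n + int i)
                    + (int (l i) - int n + int i) ^ 2) / qfac q (l i))
         * (\<Prod>i=1..n. \<Prod>j=i+1..n. 1 - q powi (int (l i) - int (l j))))
       has_sum
         ((- 1) ^ ((n choose 2) + n)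
          * (\<Prod>i=1..n.
               qpoch_inf (q ^ 5) (q ^ 5) / qpoch_inf q q
               * h powi ((2 * (int n - int i) + 1) * (int n - int i + 1)))
          * det_upto n (\<lambda>i j.
              h powi ((2 * int j - 1) * (int n - int i + 1))
              * qtheta (q powi (6 + 4 * int n - 4 * int i + int j)) (q ^ 5)
              - h powi (- ((2 * int j - 1) * (int n - int i + 1)))
              * qtheta (q powi (7 + 4 * int n - 4 * int i - int j)) (q ^ 5))))
      (nat_tuples n)"
      unfolding rhs_B B by (rule multisum_as_det)
  qed
qed

end
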